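(* Let $s\in\mathbb{N}$. Consider the integration problem $I_k$ over the space $\widetilde H^s$ of periodic functions, and let $\tilde e(n,k,s)$ be the $n$th minimal worst case error of all algorithms that use at most $n$ function or derivative (up to order $s-1$) values. There is a number $c_s>0$ (depending only on $s$) such that $$\frac{c_s}{(n+|k|)^s}\;\le\;\tilde e(n,k,s)\;\le\;\left(\frac3{2\pi}\right)^s\frac{2}{(n+|k|)^s}$$ for all $k\in\mathbb{Z}$ and all $n\in\mathbb{N}$.
   Context: For $s\in\mathbb{N}=\{1,2,\dots\}$ let $H^s=\{f:[0,1]\to\mathbb{C} : f^{(s-1)}\text{ is absolutely continuous},\ f^{(s)}\in L_2([0,1])\}$ with inner product $$\langle f,g\rangle_s=\sum_{\ell=0}^{s-1}\int_0^1 f^{(\ell)}(x)\,dx\ \int_0^1\overline{g^{(\ell)}(x)}\,dx+\int_0^1 f^{(s)}(x)\,\overline{g^{(s)}(x)}\,dx$$ and norm $\|f\|_{H^s}=\langle f,f\rangle_s^{1/2}$. The periodic subspace is $\widetilde H^s=\{f\in H^s : f^{(\ell)}(0)=f^{(\ell)}(1)\text{ for }\ell=0,1,\dots,s-1\}$ with the same inner product. For $k\in\mathbb{Z}$, $I_k(f)=\int_0^1 f(x)\,e^{-2\pi i kx}\,dx$. Algorithms using $n$ values are linear functionals of the form $A_n(f)=\sum_{j=1}^n a_j f^{(\ell_j)}(x_j)$ with $a_j\in\mathbb{C}$, $\ell_j\in\{0,1,\dots,s-1\}$, $x_j\in[0,1]$ (all of which may depend on $k,s,n$). The worst case error is $\tilde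 e(A_n)=\sup\{|I_k(f)-A_n(f)| : f\in\widetilde H^s,\ \|f\|_{H^s}\le1\}$ and $\tilde e(n,k,s)=\inf_{A_n}\tilde e(A_n)$, the infimum being over all algorithms of this form. *)

theory Defs
  imports "HOL-Analysis.Analysis"
begin

text \<open>
  Functions on the unit interval are represented by total functions of type
  \<open>real \<Rightarrow> complex\<close>.  Derivatives are taken within \<open>{0..1}\<close>, hence are one-sided at the
  endpoints, and no definition below depends on the values outside \<open>{0..1}\<close>.
\<close>

definition deriv_unit :: "(real \<Rightarrow> complex) \<Rightarrow> real \<Rightarrow> complex" where
  "deriv_unit f x = vector_derivative f (at x within {0..1})"

definition nth_deriv :: "nat \<Rightarrow> (real \<Rightarrow> complex) \<Rightarrow> real \<Rightarrow> complex" where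
  "nth_deriv l f = (deriv_unit ^^ l) f"

definition abs_cont_on_unit :: "(real \<Rightarrow> complex) \<Rightarrow> bool" where
  "abs_cont_on_unit f \<longleftrightarrow>
     (\<forall>\<epsilon>>0. \<exists>\<delta>>0. \<forall>(m::nat) a b.
        (\<forall>i<m. 0 \<le> a i \<and> a i \<le> b i \<and> b i \<le> 1) \<longrightarrow>
        disjoint_family_on (\<lambda>i. {a i<..<b i}) {..<m} \<longrightarrow>
        (\<Sum>i<m. b i - a i) < \<delta> \<longrightarrow>
        (\<Sum>i<m. cmod (f (b i) - f (a i))) < \<epsilon>)"

definition L2_unit :: "(real \<Rightarrow> complex) \<Rightarrow> bool" where
  "L2_unit f \<longleftrightarrow>
     set_borel_measurable lebesgue {0..1} f \<and>
     set_integrable lebesgue {0..1} (\<lambda>x. (cmod (f x))\<^sup>2)"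

text \<open>
  The \<open>s\<close>-th derivative of a member of \<open>Sobolev s\<close> exists only almost everywhere; on the
  exceptional null set \<^const>\<open>vector_derivative\<close> returns an arbitrary value, which affects neither
  \<^const>\<open>L2_unit\<close> nor the integrals below.  The almost-everywhere differentiability of
  \<open>nth_deriv (s - 1) f\<close> already follows from its absolute continuity; it is
  listed as part of the meaning of \<open>nth_deriv s f\<close> being an \<open>L\<^sub>2\<close> function.
\<close>

definition Sobolev :: "nat \<Rightarrow> (real \<Rightarrow> complex) set" where
  "Sobolev s = {f.
     (\<forall>l<s - 1. \<forall>x\<in>{0..1}. nth_deriv l f differentiable (at x within {0..1})) \<and>
     abs_cont_on_unit (nth_deriv (s - 1) f) \<and>
     (AE x\<in>{0..1} in lebesgue. nth_deriv (s - 1) f differentiable (at x within {0..1})) \<and>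
     L2_unit (nth_deriv s f)}"

definition Sobolev_inner :: "nat \<Rightarrow> (real \<Rightarrow> complex) \<Rightarrow> (real \<Rightarrow> complex) \<Rightarrow> complex" where
  "Sobolev_inner s f g =
     (\<Sum>l<s. (LINT x:{0..1}|lebesgue. nth_deriv l f x) *
            (LINT x:{0..1}|lebesgue. cnj (nth_deriv l g x))) +
     (LINT x:{0..1}|lebesgue. nth_deriv s f x * cnj (nth_deriv s g x))"

definition Sobolev_norm :: "nat \<Rightarrow> (real \<Rightarrow> complex) \<Rightarrow> real" where
  "Sobolev_norm s f = sqrt (Re (Sobolev_inner s f f))"

definition periodic_Sobolev :: "nat \<Rightarrow> (real \<Rightarrow> complex) set" where
  "periodic_Sobolev s = {f \<in> Sobolev s. \<forall>l<s. nth_deriv l f 0 = nth_deriv l f 1}"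

definition osc_integral :: "int \<Rightarrow> (real \<Rightarrow> complex) \<Rightarrow> complex" where
  "osc_integral k f =
     (LINT x:{0..1}|lebesgue. f x * exp (- (2 * of_real pi * \<i> * of_int k * of_real x)))"

text \<open>Zero coefficients are allowed, so these are the algorithms using at most \<open>n\<close> values.\<close>

definition algorithms :: "nat \<Rightarrow> nat \<Rightarrow> ((real \<Rightarrow> complex) \<Rightarrow> complex) set" where
  "algorithms n s = {A. \<exists>(a :: nat \<Rightarrow> complex) l x.
     (\<forall>j<n. l j < s \<and> x j \<in> {0..1}) \<and>
     A = (\<lambda>f. \<Sum>j<n. a j * nth_deriv (l j) f (x j))}"

text \<open>Errors are extended reals, so that suprema and infima are meaningful without side
  conditions on boundedness.\<close>

definition wce :: "int \<Rightarrow> nat \<Rightarrow> ((real \<Rightarrow> complex) \<Rightarrow> complex) \<Rightarrow> ereal" where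
  "wce k s A =
     (SUP f\<in>{f \<in> periodic_Sobolev s. Sobolev_norm s f \<le> 1}.
        ereal (cmod (osc_integral k f - A f)))"

definition min_wce :: "nat \<Rightarrow> int \<Rightarrow> nat \<Rightarrow> ereal" where
  "min_wce n k s = (INF A\<in>algorithms n s. wce k s A)"

end

theory Submission
  imports Defs
begin

text \<open>
  For a periodic \<open>f\<close> the integral \<open>I\<^sub>k f\<close> is the Fourier coefficient \<open>f\<^sub>k\<close>, and integration by parts gives
  \<open>(f\<^sup>(\<^sup>s\<^sup>))\<^sub>h = (2 \<pi> i h)\<^sup>s f\<^sub>h\<close>. Since \<open>f\<^sup>(\<^sup>s\<^sup>)\<close> has \<open>L\<^sub>2\<close> norm at most \<open>1\<close> on the unit ball, Bessel's
  inequality bounds the numbers \<open>(2 \<pi> h)\<^sup>2\<^sup>s |f\<^sub>h|\<^sup>2\<close> summed over any finite set of frequencies by \<open>1\<close>.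

  Upper bound. If \<open>n \<le> 2|k|\<close>, the zero algorithm already has error at most \<open>(2 \<pi> |k|)\<^sup>-\<^sup>s\<close>, and
  \<open>n + |k| \<le> 3|k|\<close>. Otherwise the mean of \<open>f(j/n) e\<^sup>-\<^sup>2\<^sup>\<pi>\<^sup>i\<^sup>k\<^sup>j\<^sup>/\<^sup>n\<close> over \<open>j < n\<close> is used. It maps
  \<open>e\<^sup>2\<^sup>\<pi>\<^sup>i\<^sup>h\<^sup>x\<close> to \<open>1\<close> if \<open>h \<equiv> k\<close> modulo \<open>n\<close> and to \<open>0\<close> otherwise, so its error is the sum of the
  coefficients \<open>f\<^sub>h\<close> with \<open>h = k + j n\<close>, \<open>j \<noteq> 0\<close>. For these \<open>3|h| \<ge> |j| (n + |k|)\<close>, and the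
  Cauchy-Schwarz inequality together with \<open>\<Sum> 1/j\<^sup>2 \<le> 4\<close> over \<open>j \<noteq> 0\<close> yields the constant
  (\<open>modulated_mean_error\<close>).

  This aliasing argument needs the Fourier series of \<open>f\<close> to converge to \<open>f\<close> at the nodes
  (\<open>fourier_partial_sums_converge\<close>). The proof represents \<open>f(y) - f\<^sub>0\<close> as the inner product
  of \<open>f'\<close> with a sawtooth function jumping at \<open>y\<close>. The squared norm \<open>1/12\<close> of the sawtooth equals
  \<open>\<Sum> 1/(2 \<pi> h)\<^sup>2\<close> over \<open>h \<noteq> 0\<close>, by Euler's \<open>\<zeta>(2) = \<pi>\<^sup>2/6\<close>, so Bessel's inequality is an equality for it
  and its own Fourier series converges to it in \<open>L\<^sub>2\<close>. Integration by parts is available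
  because the fundamental theorem of calculus holds for absolutely continuous functions
  (\<open>fundamental_theorem_of_calculus_abs_cont\<close>).

  Lower bound. The interval is cut into \<open>m = 6(n + |k|)\<close> equal cells. The fooling function carries
  the bump \<open>sin(\<pi> m x)\<^sup>2\<^sup>s\<^sup>+\<^sup>2\<close> on each cell free of nodes, multiplied by the value of \<open>e\<^sup>2\<^sup>\<pi>\<^sup>i\<^sup>k\<^sup>x\<close> at the
  left end of the cell, and vanishes on the other cells. The bumps vanish to so high an
  order that the pieces fit together smoothly. All data are zero and the norm is at most a constant
  times \<open>m\<^sup>s\<close>.
  At least half of the cells contribute, and within a cell the phase turns by at most
  \<open>\<pi>/3\<close>, so \<open>I\<^sub>k\<close> of this function is bounded below by a constant (\<open>wce_lower\<close>).
\<close>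

section \<open>Absolutely continuous functions\<close>

lemma abs_cont_on_unitE:
  assumes "abs_cont_on_unit f" "\<epsilon> > 0"
  obtains \<delta> where "\<delta> > 0"
    "\<And>(m::nat) a b. (\<forall>i<m. 0 \<le> a i \<and> a i \<le> b i \<and> b i \<le> 1) \<Longrightarrow>
        disjoint_family_on (\<lambda>i. {a i<..<b i}) {..<m} \<Longrightarrow>
        (\<Sum>i<m. b i - a i) < \<delta> \<Longrightarrow> (\<Sum>i<m. cmod (f (b i) - f (a i))) < \<epsilon>"
proof -
  from assms(1)[unfolded abs_cont_on_unit_def, rule_format, OF assms(2)]
  obtain \<delta> where "\<delta> > 0" "\<forall>(m::nat) a b. (\<forall>i<m. 0 \<le> a i \<and> a i \<le> b i \<and> b i \<le> 1) \<longrightarrow>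
        disjoint_family_on (\<lambda>i. {a i<..<b i}) {..<m} \<longrightarrow>
        (\<Sum>i<m. b i - a i) < \<delta> \<longrightarrow> (\<Sum>i<m. cmod (f (b i) - f (a i))) < \<epsilon>"
    by (elim exE conjE)
  then show thesis by (intro that[of \<delta>]) simp_all
qed

lemma abs_cont_on_unit_continuous:
  assumes "abs_cont_on_unit f"
  shows "continuous_on {0..1} f"
proof (rule continuous_on_iff[THEN iffD2], intro ballI allI impI)
  fix x e :: real assume x: "x \<in> {0..1}" and "0 < e"
  obtain d where d: "d > 0" and ac: "\<And>(m::nat) a b. (\<forall>i<m. 0 \<le> a i \<and> a i \<le> b i \<and> b i \<le> 1) \<Longrightarrow>
        disjoint_family_on (\<lambda>i. {a i<..<b i}) {..<m} \<Longrightarrow>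
        (\<Sum>i<m. b i - a i) < d \<Longrightarrow> (\<Sum>i<m. cmod (f (b i) - f (a i))) < e"
    by (rule abs_cont_on_unitE[OF assms \<open>0 < e\<close>]) blast
  have *: "cmod (f z - f y) < e" if "0 \<le> y" "y \<le> z" "z \<le> 1" "z - y < d" for y z
    using ac[of 1 "\<lambda>_. y" "\<lambda>_. z"] that by (simp add: disjoint_family_on_def)
  show "\<exists>d>0. \<forall>x'\<in>{0..1}. dist x' x < d \<longrightarrow> dist (f x') (f x) < e"
  proof (intro exI[of _ d] conjI ballI impI d)
    fix y assume "y \<in> {0..1}" "dist y x < d"
    then show "dist (f y) (f x) < e"
      using *[of x y] *[of y x] x by (cases "x \<le> y") (auto simp: dist_norm norm_minus_commute)
  qed
qed

lemma abs_cont_on_unit_Lipschitz: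
  assumes "\<And>x y. x \<in> {0..1} \<Longrightarrow> y \<in> {0..1} \<Longrightarrow> cmod (f y - f x) \<le> B * \<bar>y - x\<bar>"
  shows "abs_cont_on_unit f"
  unfolding abs_cont_on_unit_def
proof (intro allI impI)
  fix e :: real assume "e > 0"
  define C where "C = \<bar>B\<bar> + 1"
  have C: "C > 0" "\<And>x y. x \<in> {0..1} \<Longrightarrow> y \<in> {0..1} \<Longrightarrow> cmod (f y - f x) \<le> C * \<bar>y - x\<bar>"
    unfolding C_def
    subgoal by simp
    subgoal for x y by (rule order_trans[OF assms]) (auto intro!: mult_right_mono)
    done
  show "\<exists>\<delta>>0. \<forall>(m::nat) a b. (\<forall>i<m. 0 \<le> a i \<and> a i \<le> b i \<and> b i \<le> 1) \<longrightarrow>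
        disjoint_family_on (\<lambda>i. {a i<..<b i}) {..<m} \<longrightarrow>
        (\<Sum>i<m. b i - a i) < \<delta> \<longrightarrow> (\<Sum>i<m. cmod (f (b i) - f (a i))) < e"
  proof (intro exI[of _ "e / C"] conjI allI impI)
    show "e / C > 0" using \<open>e > 0\<close> C(1) by simp
    fix m :: nat and a b :: "nat \<Rightarrow> real"
    assume ab: "\<forall>i<m. 0 \<le> a i \<and> a i \<le> b i \<and> b i \<le> 1" and len: "(\<Sum>i<m. b i - a i) < e / C"
    have "(\<Sum>i<m. cmod (f (b i) - f (a i))) \<le> (\<Sum>i<m. C * (b i - a i))"
    proof (rule sum_mono)
      fix i assume "i \<in> {..<m}"
      then show "cmod (f (b i) - f (a i)) \<le> C * (b i - a i)"
        using C(2)[of "a i" "b i"] ab by force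
    qed
    also have "\<dots> = C * (\<Sum>i<m. b i - a i)" by (simp add: sum_distrib_left)
    also have "\<dots> < e" using len C(1) by (simp add: field_simps)
    finally show "(\<Sum>i<m. cmod (f (b i) - f (a i))) < e" .
  qed
qed

lemma abs_cont_on_unit_mult:
  assumes f: "abs_cont_on_unit f" and g: "abs_cont_on_unit g"
  shows "abs_cont_on_unit (\<lambda>x. f x * g x)"
proof -
  have bounded: "\<exists>B>0. \<forall>x\<in>{0..1}. cmod (h x) \<le> B" if "abs_cont_on_unit h" for h
  proof -
    have "bounded (h ` {0..1})"
      by (intro compact_imp_bounded compact_continuous_image abs_cont_on_unit_continuous that) simp
    then show ?thesis by (auto simp: bounded_pos)
  qed
  obtain B C where B: "B > 0" "\<And>x. x \<in> {0..1} \<Longrightarrow> cmod (f x) \<le> B"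
    and C: "C > 0" "\<And>x. x \<in> {0..1} \<Longrightarrow> cmod (g x) \<le> C"
    using bounded[OF f] bounded[OF g] by auto
  show ?thesis
    unfolding abs_cont_on_unit_def
  proof (intro allI impI)
    fix e :: real assume "e > 0"
    then have "e / (2 * C) > 0" "e / (2 * B) > 0" using B C by auto
    note pos = this
    obtain d where d: "d > 0" "\<And>(m::nat) a b. (\<forall>i<m. 0 \<le> a i \<and> a i \<le> b i \<and> b i \<le> 1) \<Longrightarrow>
        disjoint_family_on (\<lambda>i. {a i<..<b i}) {..<m} \<Longrightarrow>
        (\<Sum>i<m. b i - a i) < d \<Longrightarrow> (\<Sum>i<m. cmod (f (b i) - f (a i))) < e / (2 * C)"
      by (rule abs_cont_on_unitE[OF f pos(1)]) blast
    obtain d' where d': "d' > 0" "\<And>(m::nat) a b. (\<forall>i<m. 0 \<le> a i \<and> a i \<le> b i \<and> b i \<le> 1) \<Longrightarrow>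
        disjoint_family_on (\<lambda>i. {a i<..<b i}) {..<m} \<Longrightarrow>
        (\<Sum>i<m. b i - a i) < d' \<Longrightarrow> (\<Sum>i<m. cmod (g (b i) - g (a i))) < e / (2 * B)"
      by (rule abs_cont_on_unitE[OF g pos(2)]) blast
    show "\<exists>\<delta>>0. \<forall>(m::nat) a b. (\<forall>i<m. 0 \<le> a i \<and> a i \<le> b i \<and> b i \<le> 1) \<longrightarrow>
        disjoint_family_on (\<lambda>i. {a i<..<b i}) {..<m} \<longrightarrow>
        (\<Sum>i<m. b i - a i) < \<delta> \<longrightarrow> (\<Sum>i<m. cmod (f (b i) * g (b i) - f (a i) * g (a i))) < e"
    proof (intro exI[of _ "min d d'"] conjI allI impI)
      show "min d d' > 0" using d d' by simp
      fix m :: nat and a b :: "nat \<Rightarrow> real"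
      assume ab: "\<forall>i<m. 0 \<le> a i \<and> a i \<le> b i \<and> b i \<le> 1"
        and dis: "disjoint_family_on (\<lambda>i. {a i<..<b i}) {..<m}"
        and len: "(\<Sum>i<m. b i - a i) < min d d'"
      have "(\<Sum>i<m. cmod (f (b i) * g (b i) - f (a i) * g (a i)))
            \<le> (\<Sum>i<m. B * cmod (g (b i) - g (a i)) + C * cmod (f (b i) - f (a i)))"
      proof (rule sum_mono)
        fix i assume "i \<in> {..<m}"
        then have i: "a i \<in> {0..1}" "b i \<in> {0..1}" using ab by force+
        have "f (b i) * g (b i) - f (a i) * g (a i)
            = f (b i) * (g (b i) - g (a i)) + g (a i) * (f (b i) - f (a i))"
          by (simp add: algebra_simps)
        also have "cmod \<dots> \<le> cmod (f (b i)) * cmod (g (b i) - g (a i)) + cmod (g (a i)) * cmod (f (b i) - f (a i))"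
          by (metis norm_mult norm_triangle_ineq)
        also have "\<dots> \<le> B * cmod (g (b i) - g (a i)) + C * cmod (f (b i) - f (a i))"
          using B C i by (intro add_mono mult_right_mono) auto
        finally show "cmod (f (b i) * g (b i) - f (a i) * g (a i)) \<le> \<dots>" .
      qed
      also have "\<dots> = B * (\<Sum>i<m. cmod (g (b i) - g (a i))) + C * (\<Sum>i<m. cmod (f (b i) - f (a i)))"
        by (simp add: sum.distrib sum_distrib_left)
      also have "\<dots> < B * (e / (2 * B)) + C * (e / (2 * C))"
        using d(2)[OF ab dis] d'(2)[OF ab dis] len B(1) C(1) by (intro add_strict_mono mult_strict_left_mono) auto
      also have "\<dots> = e" using B C by (simp add: field_simps)
      finally show "(\<Sum>i<m. cmod (f (b i) * g (b i) - f (a i) * g (a i))) < e" .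
    qed
  qed
qed

text \<open>
  The part of a Henstock sum with tags in a null set is controlled as follows: a gauge can force
  its intervals into an open set of small measure, and absolute continuity then makes the total
  increment of \<open>f\<close> over these disjoint intervals small.
\<close>

lemma sum_variation_small_of_abs_cont:
  assumes ac: "\<And>(m::nat) a b. (\<forall>i<m. 0 \<le> a i \<and> a i \<le> b i \<and> b i \<le> 1) \<Longrightarrow>
        disjoint_family_on (\<lambda>i. {a i<..<b i}) {..<m} \<Longrightarrow>
        (\<Sum>i<m. b i - a i) < \<delta> \<Longrightarrow> (\<Sum>i<m. cmod (f (b i) - f (a i))) < \<epsilon>"
    and U: "U \<in> lmeasurable" "measure lebesgue U < \<delta>"
    and q: "finite q" "q tagged_partial_division_of {a..b}" and sub: "\<And>x K. (x, K) \<in> q \<Longrightarrow> K \<subseteq> U"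
    and ab: "0 \<le> a" "b \<le> 1"
  shows "(\<Sum>(x,K)\<in>q. cmod (f (Sup K) - f (Inf K))) < \<epsilon>"
proof -
  obtain h where h: "bij_betw h {..<card q} q"
    using ex_bij_betw_nat_finite[OF q(1)] by (auto simp: atLeast0LessThan)
  define L R where "L i = Inf (snd (h i))" and "R i = Sup (snd (h i))" for i
  have K: "snd (h i) = {L i..R i} \<and> L i \<le> R i \<and> 0 \<le> L i \<and> R i \<le> 1 \<and> {L i..R i} \<subseteq> U" if "i < card q" for i
  proof -
    have "h i \<in> q" using h that by (auto simp: bij_betw_def)
    then obtain x K where hi: "h i = (x, K)" "(x, K) \<in> q" by (cases "h i") auto
    then obtain u v where uv: "K = {u..v}" "x \<in> K" "K \<subseteq> {a..b}"
      using tagged_partial_division_ofD(2-4)[OF q(2) hi(2)] by auto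
    then have "u \<le> v" by auto
    then show ?thesis using uv hi sub[OF hi(2)] ab by (auto simp: L_def R_def)
  qed
  have disj: "disjoint_family_on (\<lambda>i. {L i<..<R i}) {..<card q}"
    unfolding disjoint_family_on_def
  proof (intro ballI impI)
    fix i j assume ij: "i \<in> {..<card q}" "j \<in> {..<card q}" "i \<noteq> j"
    then have "h i \<in> q" "h j \<in> q" "h i \<noteq> h j"
      using h by (auto simp: bij_betw_def inj_on_def)
    then have "interior (snd (h i)) \<inter> interior (snd (h j)) = {}"
      using tagged_partial_division_ofD(5)[OF q(2), of "fst (h i)" "snd (h i)" "fst (h j)" "snd (h j)"]
      by simp
    then show "{L i<..<R i} \<inter> {L j<..<R j} = {}"
      using K[of i] K[of j] ij by simp
  qed
  have "(\<Sum>i<card q. R i - L i) = (\<Sum>i<card q. measure lebesgue {L i<..<R i})"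
    using K by (intro sum.cong refl) simp
  also have "\<dots> = measure lebesgue (\<Union>i<card q. {L i<..<R i})"
    using disj by (subst measure_UNION') (auto simp: disjoint_family_on_def pairwise_def disjnt_def)
  also have "\<dots> \<le> measure lebesgue U"
    using K U by (intro measure_mono_fmeasurable UN_least) (force, auto)
  finally have "(\<Sum>i<card q. R i - L i) < \<delta>" using U by linarith
  then have "(\<Sum>i<card q. cmod (f (R i) - f (L i))) < \<epsilon>"
    using K disj by (intro ac) auto
  also have "(\<Sum>i<card q. cmod (f (R i) - f (L i))) = (\<Sum>(x,K)\<in>q. cmod (f (Sup K) - f (Inf K)))"
    using sum.reindex_bij_betw[OF h, of "\<lambda>(x,K). cmod (f (Sup K) - f (Inf K))"]
    by (simp add: L_def R_def case_prod_unfold)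
  finally show ?thesis .
qed

text \<open>
  In the gauge integral, a tag at which \<open>f\<close> is differentiable is treated by the definition of the
  derivative, as in the classical proof. At tags in the null set \<open>N\<close> the integrand may be set to
  zero, and the increments of \<open>f\<close> there are small by
  \<open>sum_variation_small_of_abs_cont\<close>.
\<close>

theorem fundamental_theorem_of_calculus_abs_cont:
  fixes f f' :: "real \<Rightarrow> complex"
  assumes ac: "abs_cont_on_unit f"
    and neg: "negligible N"
    and der: "\<And>x. x \<in> {0..1} - N \<Longrightarrow> (f has_vector_derivative f' x) (at x within {0..1})"
    and ab: "0 \<le> a" "a \<le> b" "b \<le> 1"
  shows "(f' has_integral (f b - f a)) {a..b}"
proof -
  \<comment> \<open>Zero on \<open>N\<close>, so that exceptional tags contribute only increments of \<open>f\<close>.\<close>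
  define g where "g x = (if x \<in> N then 0 else f' x)" for x
  have "(g has_integral (f b - f a)) {a..b}"
    unfolding has_integral_real
  proof (intro allI impI)
    fix \<epsilon> :: real assume "\<epsilon> > 0"
    define e where "e = \<epsilon> / 3"
    have e: "e > 0" using \<open>\<epsilon> > 0\<close> by (simp add: e_def)
    obtain \<delta> where \<delta>: "\<delta> > 0" "\<And>(m::nat) a b. (\<forall>i<m. 0 \<le> a i \<and> a i \<le> b i \<and> b i \<le> 1) \<Longrightarrow>
        disjoint_family_on (\<lambda>i. {a i<..<b i}) {..<m} \<Longrightarrow>
        (\<Sum>i<m. b i - a i) < \<delta> \<Longrightarrow> (\<Sum>i<m. cmod (f (b i) - f (a i))) < e"
      by (rule abs_cont_on_unitE[OF ac e]) blast
    have N: "N \<in> null_sets lebesgue" using neg by (simp add: negligible_iff_null_sets)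
    obtain U where U: "open U" "N \<subseteq> U" "U \<in> lmeasurable" "measure lebesgue U < \<delta>"
    proof -
      obtain T where T: "open T" "N \<subseteq> T" "T - N \<in> lmeasurable" "emeasure lebesgue (T - N) < ennreal \<delta>"
        using sets_lebesgue_outer_open[of N \<delta>] N \<delta>(1) by auto
      have "T \<in> lmeasurable"
        using T N by (metis borel_open measurable_Diff_null_set sets_completionI_sets sets_lborel)
      moreover have "measure lebesgue T = measure lebesgue (T - N)"
        using T N by (simp add: measure_Diff_null_set)
      moreover have "measure lebesgue (T - N) < \<delta>"
        using T \<delta>(1) by (simp add: emeasure_eq_measure2 ennreal_less_iff)
      ultimately show thesis using that T by simp
    qed
    have "\<forall>x. \<exists>d>0. (x \<in> {0..1} - N \<longrightarrow>
         (\<forall>y\<in>{0..1}. norm (y-x) < d \<longrightarrow> norm (f y - f x - (y-x) *\<^sub>R f' x) \<le> e * norm (y-x)))"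
      using der[unfolded has_vector_derivative_def has_derivative_within_alt] e by (metis zero_less_one)
    then obtain d where d: "\<And>x. 0 < d x"
       "\<And>x y. \<lbrakk>x \<in> {0..1} - N; y \<in> {0..1}; norm (y-x) < d x\<rbrakk>
                        \<Longrightarrow> norm (f y - f x - (y-x) *\<^sub>R f' x) \<le> e * norm (y-x)"
      by metis
    define \<gamma> where "\<gamma> x = (if x \<in> N then U else ball x (d x))" for x
    have "gauge \<gamma>" using U d(1) by (auto simp: gauge_def \<gamma>_def)
    moreover have "norm ((\<Sum>(x, K)\<in>p. measure lborel K *\<^sub>R g x) - (f b - f a)) < \<epsilon>"
      if p: "p tagged_division_of {a..b}" and fine: "\<gamma> fine p" for p
    proof -
      have fin: "finite p" using p by blast
      have sum_eq: "b - a = (\<Sum>(x,K)\<in>p. Sup K - Inf K)" "f b - f a = (\<Sum>(x,K)\<in>p. f(Sup K) - f(Inf K))"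
        using additive_tagged_division_1[where f= "\<lambda>x. x"] additive_tagged_division_1[where f= f]
            ab p by auto
      define q where "q = {z \<in> p. fst z \<in> N}"
      have exceptional: "(\<Sum>(x,K)\<in>q. cmod (f (Sup K) - f (Inf K))) < e"
      proof (rule sum_variation_small_of_abs_cont[OF \<delta>(2) U(3,4)])
        show "q tagged_partial_division_of {a..b}"
          using p by (auto simp: q_def tagged_division_of_def intro: tagged_partial_division_subset)
        show "K \<subseteq> U" if "(x, K) \<in> q" for x K
          using fineD[OF fine, of x K] that by (simp add: q_def \<gamma>_def)
      qed (use fin ab in \<open>auto simp: q_def\<close>)
      have regular: "norm (measure lborel K *\<^sub>R g x - (f (Sup K) - f (Inf K))) \<le> e * (Sup K - Inf K)"
        if xK: "(x, K) \<in> p - q" for x K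
      proof -
        have "(x, K) \<in> p" "x \<notin> N" using xK by (auto simp: q_def)
        then obtain u v where uv: "K = {u..v}" "x \<in> K" "K \<subseteq> {a..b}"
          using tagged_division_ofD(2-4)[OF p \<open>(x, K) \<in> p\<close>] by auto
        then have "u \<le> v" "u \<in> K" "v \<in> K" by auto
        have ball: "y \<in> K \<Longrightarrow> norm (y - x) < d x" for y
          using fine \<open>(x, K) \<in> p\<close> \<open>x \<notin> N\<close> by (force simp: fine_def \<gamma>_def dist_real_def)
        have "norm ((v - u) *\<^sub>R f' x - (f v - f u))
            = norm ((f u - f x - (u - x) *\<^sub>R f' x) - (f v - f x - (v - x) *\<^sub>R f' x))"
          by (auto simp: algebra_simps)
        also have "\<dots> \<le> norm (f u - f x - (u - x) *\<^sub>R f' x) + norm (f v - f x - (v - x) *\<^sub>R f' x)"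
          by (rule norm_triangle_ineq4)
        also have "\<dots> \<le> e * norm (u - x) + e * norm (v - x)"
          using uv ab \<open>u \<in> K\<close> \<open>v \<in> K\<close> \<open>x \<notin> N\<close> by (intro add_mono d(2) ball) auto
        also have "\<dots> = e * (v - u)"
          using uv by (auto simp: algebra_simps)
        finally show ?thesis
          using \<open>u \<le> v\<close> \<open>x \<notin> N\<close> by (simp add: uv g_def)
      qed
      have nn: "Sup K - Inf K \<ge> 0" if xK: "(x,K) \<in> p" for x K
      proof -
        obtain u v where "K = {u..v}" "x \<in> K"
          using tagged_division_ofD(2,4)[OF p xK] by auto
        then show ?thesis by auto
      qed
      have "(\<Sum>(x, K)\<in>p. measure lborel K *\<^sub>R g x) - (f b - f a)
          = (\<Sum>(x,K)\<in>p. measure lborel K *\<^sub>R g x - (f (Sup K) - f (Inf K)))"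
        by (simp add: sum_eq split_def sum_subtractf)
      also have "norm \<dots> \<le> (\<Sum>(x,K)\<in>p. norm (measure lborel K *\<^sub>R g x - (f (Sup K) - f (Inf K))))"
        by (rule order_trans[OF norm_sum]) (simp add: split_def)
      also have "\<dots> = (\<Sum>(x,K)\<in>p - q. norm (measure lborel K *\<^sub>R g x - (f (Sup K) - f (Inf K))))
          + (\<Sum>(x,K)\<in>q. norm (measure lborel K *\<^sub>R g x - (f (Sup K) - f (Inf K))))"
        by (rule sum.subset_diff) (use fin in \<open>auto simp: q_def\<close>)
      also have "(\<Sum>(x,K)\<in>q. norm (measure lborel K *\<^sub>R g x - (f (Sup K) - f (Inf K))))
          = (\<Sum>(x,K)\<in>q. cmod (f (Sup K) - f (Inf K)))"
        by (intro sum.cong refl) (auto simp: q_def g_def norm_minus_commute)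
      also have "(\<Sum>(x,K)\<in>p - q. norm (measure lborel K *\<^sub>R g x - (f (Sup K) - f (Inf K))))
          \<le> (\<Sum>(x,K)\<in>p - q. e * (Sup K - Inf K))"
        by (rule sum_mono) (use regular in auto)
      also have "\<dots> \<le> (\<Sum>(x,K)\<in>p. e * (Sup K - Inf K))"
        using fin nn e by (intro sum_mono2) auto
      also have "\<dots> = e * (b - a)" by (simp add: sum_eq split_def sum_distrib_left)
      also have "\<dots> \<le> e * 1" using e ab by (intro mult_left_mono) auto
      finally show ?thesis using exceptional e by (simp add: e_def)
    qed
    ultimately show "\<exists>\<gamma>. gauge \<gamma> \<and> (\<forall>p. p tagged_division_of {a..b} \<and> \<gamma> fine p \<longrightarrow>
        norm ((\<Sum>(x, K)\<in>p. measure lborel K *\<^sub>R g x) - (f b - f a)) < \<epsilon>)"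
      by (intro exI[of _ \<gamma>] conjI allI impI) simp_all
  qed
  then show ?thesis
    by (rule has_integral_spike[OF neg, rotated]) (simp add: g_def)
qed

section \<open>Square-integrable functions and Bessel's inequality\<close>

lemma L2_unit_iff:
  "L2_unit f \<longleftrightarrow> f \<in> borel_measurable (lebesgue_on {0..1}) \<and>
     (\<lambda>x. (cmod (f x))\<^sup>2) absolutely_integrable_on {0..1}"
  unfolding L2_unit_def set_borel_measurable_def
  by (subst borel_measurable_restrict_space_iff) auto

lemma L2_unit_bounded:
  assumes "f \<in> borel_measurable (lebesgue_on {0..1})" "\<And>x. x \<in> {0..1} \<Longrightarrow> cmod (f x) \<le> B"
  shows "L2_unit f"
  unfolding L2_unit_iff
proof
  show "(\<lambda>x. (cmod (f x))\<^sup>2) absolutely_integrable_on {0..1}"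
  proof (rule measurable_bounded_by_integrable_imp_absolutely_integrable)
    show "(\<lambda>x. (cmod (f x))\<^sup>2) \<in> borel_measurable (lebesgue_on {0..1})" using assms(1) by measurable
    show "(\<lambda>x. B\<^sup>2) integrable_on {0..1::real}" by (rule integrable_const_ivl)
    show "norm ((cmod (f x))\<^sup>2) \<le> B\<^sup>2" if "x \<in> {0..1}" for x
      using assms(2)[OF that] by (simp add: power_mono)
  qed auto
qed (fact assms(1))

lemma L2_unit_continuous:
  assumes "continuous_on {0..1} f"
  shows "L2_unit f"
proof -
  have "bounded (f ` {0..1})"
    by (intro compact_imp_bounded compact_continuous_image assms) simp
  then obtain B where "\<forall>x\<in>{0..1}. cmod (f x) \<le> B" by (auto simp: bounded_iff)
  then show ?thesis
    by (intro L2_unit_bounded[of _ B] continuous_imp_measurable_on_sets_lebesgue assms) auto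
qed

lemma L2_unit_cmult:
  assumes "L2_unit f"
  shows "L2_unit (\<lambda>x. c * f x)"
  using assms unfolding L2_unit_iff by (auto simp: norm_mult power_mult_distrib)

lemma L2_unit_diff:
  assumes "L2_unit f" "L2_unit g"
  shows "L2_unit (\<lambda>x. f x - g x)"
  unfolding L2_unit_iff
proof
  show m: "(\<lambda>x. f x - g x) \<in> borel_measurable (lebesgue_on {0..1})"
    using assms unfolding L2_unit_iff by auto
  show "(\<lambda>x. (cmod (f x - g x))\<^sup>2) absolutely_integrable_on {0..1}"
  proof (rule measurable_bounded_by_integrable_imp_absolutely_integrable)
    show "(\<lambda>x. (cmod (f x - g x))\<^sup>2) \<in> borel_measurable (lebesgue_on {0..1})" using m by measurable
    show "(\<lambda>x. 2 * (cmod (f x))\<^sup>2 + 2 * (cmod (g x))\<^sup>2) integrable_on {0..1::real}"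
      using assms unfolding L2_unit_iff
      by (intro integrable_add integrable_on_mult_right set_lebesgue_integral_eq_integral(1)) auto
    show "norm ((cmod (f x - g x))\<^sup>2) \<le> 2 * (cmod (f x))\<^sup>2 + 2 * (cmod (g x))\<^sup>2" for x
    proof -
      have "(cmod (f x - g x))\<^sup>2 \<le> (cmod (f x) + cmod (g x))\<^sup>2"
        by (intro power_mono norm_triangle_ineq4) auto
      also have "\<dots> \<le> 2 * (cmod (f x))\<^sup>2 + 2 * (cmod (g x))\<^sup>2"
        using zero_le_power2[of "cmod (f x) - cmod (g x)"] by (simp add: power2_eq_square algebra_simps)
      finally show ?thesis by simp
    qed
  qed auto
qed

lemma L2_unit_inner_absolutely_integrable:
  assumes "L2_unit f" "L2_unit g"
  shows "(\<lambda>x. f x * cnj (g x)) absolutely_integrable_on {0..1}"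
proof (rule measurable_bounded_by_integrable_imp_absolutely_integrable)
  have "cnj \<in> borel_measurable borel" by (intro borel_measurable_continuous_onI continuous_intros)
  then show "(\<lambda>x. f x * cnj (g x)) \<in> borel_measurable (lebesgue_on {0..1})"
    using assms unfolding L2_unit_iff by (auto intro!: borel_measurable_times measurable_compose[of g _ _ cnj])
  show "(\<lambda>x. (cmod (f x))\<^sup>2 + (cmod (g x))\<^sup>2) integrable_on {0..1::real}"
    using assms unfolding L2_unit_iff
    by (intro integrable_add set_lebesgue_integral_eq_integral(1)) auto
  show "norm (f x * cnj (g x)) \<le> (cmod (f x))\<^sup>2 + (cmod (g x))\<^sup>2" for x
  proof -
    have "2 * (cmod (f x) * cmod (g x)) \<le> (cmod (f x))\<^sup>2 + (cmod (g x))\<^sup>2"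
      using zero_le_power2[of "cmod (f x) - cmod (g x)"] by (simp add: power2_eq_square algebra_simps)
    moreover have "0 \<le> cmod (f x) * cmod (g x)" by simp
    ultimately have "cmod (f x) * cmod (g x) \<le> (cmod (f x))\<^sup>2 + (cmod (g x))\<^sup>2" by linarith
    then show ?thesis by (simp add: norm_mult)
  qed
qed auto

definition L2_inner :: "(real \<Rightarrow> complex) \<Rightarrow> (real \<Rightarrow> complex) \<Rightarrow> complex" where
  "L2_inner f g = integral {0..1} (\<lambda>x. f x * cnj (g x))"

definition L2_energy :: "(real \<Rightarrow> complex) \<Rightarrow> real" where
  "L2_energy f = integral {0..1} (\<lambda>x. (cmod (f x))\<^sup>2)"

lemma has_integral_L2_inner:
  assumes "L2_unit f" "L2_unit g"
  shows "((\<lambda>x. f x * cnj (g x)) has_integral L2_inner f g) {0..1}"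
  unfolding L2_inner_def
  by (intro integrable_integral set_lebesgue_integral_eq_integral(1)
       L2_unit_inner_absolutely_integrable assms)

lemma has_integral_L2_energy:
  assumes "L2_unit f"
  shows "((\<lambda>x. (cmod (f x))\<^sup>2) has_integral L2_energy f) {0..1}"
  using assms unfolding L2_energy_def L2_unit_iff
  by (intro integrable_integral set_lebesgue_integral_eq_integral(1)) auto

lemma L2_energy_nonneg: "L2_energy f \<ge> 0"
  unfolding L2_energy_def
  by (cases "(\<lambda>x. (cmod (f x))\<^sup>2) integrable_on {0..1}")
     (auto intro: Henstock_Kurzweil_Integration.integral_nonneg simp: not_integrable_integral)

lemma L2_inner_diff_left:
  assumes "L2_unit f" "L2_unit g" "L2_unit h"
  shows "L2_inner (\<lambda>x. f x - g x) h = L2_inner f h - L2_inner g h"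
  using has_integral_diff[OF has_integral_L2_inner[OF assms(1,3)] has_integral_L2_inner[OF assms(2,3)]]
  unfolding L2_inner_def[of "\<lambda>x. f x - g x"] by (intro integral_unique) (simp add: left_diff_distrib)

lemma L2_inner_cmult_left:
  assumes "L2_unit f" "L2_unit g"
  shows "L2_inner (\<lambda>x. c * f x) g = c * L2_inner f g"
  using has_integral_mult_right[OF has_integral_L2_inner[OF assms], of c]
  unfolding L2_inner_def[of "\<lambda>x. c * f x"] by (intro integral_unique) (simp add: mult.assoc)

text \<open>
  Expanding the square. With \<open>c\<close> a multiple of \<open>\<langle>f, g\<rangle>\<close> this gives the Cauchy-Schwarz inequality,
  and with \<open>g\<close> a character it is the step that removes one frequency from \<open>f\<close>.
\<close>

lemma L2_energy_diff_cmult: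
  assumes "L2_unit f" "L2_unit g"
  shows "L2_energy (\<lambda>x. f x - c * g x)
         = L2_energy f - 2 * Re (cnj c * L2_inner f g) + (cmod c)\<^sup>2 * L2_energy g"
proof -
  have "((\<lambda>x. Re (cnj c * (f x * cnj (g x)))) has_integral Re (cnj c * L2_inner f g)) {0..1}"
    by (intro has_integral_Re has_integral_mult_right has_integral_L2_inner assms)
  then have "((\<lambda>x. (cmod (f x))\<^sup>2 - 2 * Re (cnj c * (f x * cnj (g x))) + (cmod c)\<^sup>2 * (cmod (g x))\<^sup>2)
      has_integral L2_energy f - 2 * Re (cnj c * L2_inner f g) + (cmod c)\<^sup>2 * L2_energy g) {0..1}"
    by (intro has_integral_add has_integral_diff has_integral_mult_right has_integral_L2_energy assms)
  moreover have "(cmod (f x))\<^sup>2 - 2 * Re (cnj c * (f x * cnj (g x))) + (cmod c)\<^sup>2 * (cmod (g x))\<^sup>2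
      = (cmod (f x - c * g x))\<^sup>2" for x
    unfolding cmod_power2 by (simp add: power2_eq_square algebra_simps)
  ultimately show ?thesis unfolding L2_energy_def[of "\<lambda>x. f x - c * g x"] by (simp add: integral_unique)
qed

lemma L2_Cauchy_Schwarz:
  assumes "L2_unit f" "L2_unit g"
  shows "(cmod (L2_inner f g))\<^sup>2 \<le> L2_energy f * L2_energy g"
proof -
  let ?z = "L2_inner f g"
  have *: "0 \<le> L2_energy f - 2 * t * (cmod ?z)\<^sup>2 + t\<^sup>2 * (cmod ?z)\<^sup>2 * L2_energy g" for t
  proof -
    have "Re (cnj (of_real t * ?z) * ?z) = t * (cmod ?z)\<^sup>2"
      unfolding cmod_power2 by (simp add: power2_eq_square algebra_simps)
    moreover have "(cmod (of_real t * ?z))\<^sup>2 = t\<^sup>2 * (cmod ?z)\<^sup>2"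
      by (simp add: norm_mult power_mult_distrib)
    ultimately show ?thesis
      using L2_energy_diff_cmult[OF assms, of "of_real t * ?z"]
        L2_energy_nonneg[of "\<lambda>x. f x - of_real t * ?z * g x"] by simp
  qed
  show ?thesis
  proof (cases "L2_energy g = 0")
    case True
    have "(cmod ?z)\<^sup>2 \<le> 0"
    proof (rule ccontr)
      assume "\<not> (cmod ?z)\<^sup>2 \<le> 0"
      then have "2 * ((L2_energy f + 1) / (cmod ?z)\<^sup>2) * (cmod ?z)\<^sup>2 = 2 * (L2_energy f + 1)" by simp
      then show False using *[of "(L2_energy f + 1) / (cmod ?z)\<^sup>2"] True L2_energy_nonneg[of f] by simp
    qed
    then show ?thesis using True by simp
  next
    case False
    then have pos: "L2_energy g > 0" using L2_energy_nonneg[of g] by simp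
    have "0 \<le> L2_energy f - (cmod ?z)\<^sup>2 / L2_energy g"
      using *[of "1 / L2_energy g"] pos by (simp add: power2_eq_square field_simps)
    then show ?thesis using pos by (simp add: field_simps)
  qed
qed

section \<open>Fourier coefficients\<close>

definition fourier_char :: "int \<Rightarrow> real \<Rightarrow> complex" where
  "fourier_char h x = exp (2 * of_real pi * \<i> * of_int h * of_real x)"

definition fourier_coeff :: "(real \<Rightarrow> complex) \<Rightarrow> int \<Rightarrow> complex" where
  "fourier_coeff f h = L2_inner f (fourier_char h)"

lemma fourier_char_simps [simp]:
  "fourier_char 0 x = 1" "fourier_char h 0 = 1" "fourier_char h 1 = 1"
  "cmod (fourier_char h x) = 1"
proof -
  show "fourier_char h 1 = 1"
    using exp_integer_2pi[of "of_int h"] by (simp add: fourier_char_def mult_ac)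
qed (auto simp: fourier_char_def)

lemma cnj_fourier_char: "cnj (fourier_char h x) = fourier_char (- h) x"
  by (simp add: fourier_char_def exp_cnj)

lemma fourier_char_add: "fourier_char (g + h) x = fourier_char g x * fourier_char h x"
  by (simp add: fourier_char_def exp_add[symmetric] algebra_simps)

lemma fourier_char_vector_derivative:
  "(fourier_char h has_vector_derivative 2 * of_real pi * \<i> * of_int h * fourier_char h x) (at x within S)"
proof -
  have "((\<lambda>z. exp (2 * of_real pi * \<i> * of_int h * z)) has_field_derivative
      2 * of_real pi * \<i> * of_int h * fourier_char h x) (at (of_real x))"
    unfolding fourier_char_def by (auto intro!: derivative_eq_intros)
  from has_vector_derivative_at_within[OF has_vector_derivative_real_field[OF this]]
  show ?thesis by (simp add: fourier_char_def[abs_def])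
qed

lemma continuous_on_fourier_char: "continuous_on S (fourier_char h)"
  unfolding fourier_char_def by (intro continuous_intros)

lemma L2_unit_fourier_char: "L2_unit (fourier_char h)"
  by (intro L2_unit_continuous continuous_on_fourier_char)

lemma fourier_char_orthonormal: "L2_inner (fourier_char g) (fourier_char h) = of_bool (g = h)"
proof (cases "g = h")
  case True
  then have "fourier_char g x * cnj (fourier_char h x) = 1" for x
    by (simp add: cnj_fourier_char flip: fourier_char_add)
  then show ?thesis using True by (simp add: L2_inner_def)
next
  case False
  define c where "c = 2 * of_real pi * \<i> * of_int (g - h)"
  have c: "c \<noteq> 0" using False by (simp add: c_def)
  have "((\<lambda>x. c * fourier_char (g - h) x) has_integral fourier_char (g - h) 1 - fourier_char (g - h) 0) {0..1}"
    unfolding c_def by (intro fundamental_theorem_of_calculus fourier_char_vector_derivative) simp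
  then have "((\<lambda>x. c * fourier_char (g - h) x) has_integral 0) {0..1}" by simp
  from has_integral_mult_right[OF this, of "1 / c"] c
  have "(fourier_char (g - h) has_integral 0) {0..1}" by simp
  moreover have "fourier_char g x * cnj (fourier_char h x) = fourier_char (g - h) x" for x
    by (simp add: cnj_fourier_char flip: fourier_char_add)
  ultimately show ?thesis using False by (simp add: L2_inner_def integral_unique)
qed

lemma L2_energy_fourier_char: "L2_energy (fourier_char h) = 1"
  by (simp add: L2_energy_def)

text \<open>
  Removing one more frequency \<open>h\<close> lowers the energy by exactly \<open>|f\<^sub>h|\<^sup>2\<close>, because by orthogonality
  the earlier removals left the coefficient at \<open>h\<close> unchanged. That is why the third claim has to be
  carried along in the induction. The exact value of the energy, and not just
  Bessel's inequality, is needed for the sawtooth function.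
\<close>

lemma L2_energy_fourier_residual:
  assumes f: "L2_unit f" and "finite F"
  shows "L2_unit (\<lambda>x. f x - (\<Sum>h\<in>F. fourier_coeff f h * fourier_char h x))"
    and "L2_energy (\<lambda>x. f x - (\<Sum>h\<in>F. fourier_coeff f h * fourier_char h x))
         = L2_energy f - (\<Sum>h\<in>F. (cmod (fourier_coeff f h))\<^sup>2)"
    and "k \<notin> F \<Longrightarrow>
      L2_inner (\<lambda>x. f x - (\<Sum>h\<in>F. fourier_coeff f h * fourier_char h x)) (fourier_char k) = fourier_coeff f k"
  using \<open>finite F\<close>
proof (induction F arbitrary: k)
  case empty
  { case 1 show ?case using f by simp }
  { case 2 show ?case by simp }
  { case 3 show ?case by (simp add: fourier_coeff_def) }
next
  case (insert h F)
  let ?r = "\<lambda>x. f x - (\<Sum>h\<in>F. fourier_coeff f h * fourier_char h x)"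
  let ?c = "fourier_coeff f h"
  have eq: "(\<lambda>x. f x - (\<Sum>g\<in>insert h F. fourier_coeff f g * fourier_char g x))
          = (\<lambda>x. ?r x - ?c * fourier_char h x)"
    using insert.hyps by (simp add: algebra_simps)
  have r: "L2_unit ?r" by (rule insert.IH(1))
  { case 1 show ?case unfolding eq
      by (intro L2_unit_diff r L2_unit_cmult L2_unit_fourier_char) }
  { case 2
    have "Re (cnj ?c * ?c) = (cmod ?c)\<^sup>2" unfolding cmod_power2 by (simp add: power2_eq_square)
    then show ?case
      unfolding eq L2_energy_diff_cmult[OF r L2_unit_fourier_char]
        insert.IH(3)[OF insert.hyps(2)] insert.IH(2) L2_energy_fourier_char
      using insert.hyps by simp }
  { case 3
    then show ?case
      unfolding eq L2_inner_diff_left[OF r L2_unit_cmult[OF L2_unit_fourier_char] L2_unit_fourier_char]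
        L2_inner_cmult_left[OF L2_unit_fourier_char L2_unit_fourier_char] fourier_char_orthonormal
      using insert.IH(3)[of k] by auto }
qed

lemma Bessel_inequality:
  assumes "L2_unit f" "finite F"
  shows "(\<Sum>h\<in>F. (cmod (fourier_coeff f h))\<^sup>2) \<le> L2_energy f"
  using L2_energy_fourier_residual(2)[OF assms]
    L2_energy_nonneg[of "\<lambda>x. f x - (\<Sum>h\<in>F. fourier_coeff f h * fourier_char h x)"] by simp

section \<open>Weak derivatives and integration by parts\<close>

text \<open>
  The relation between consecutive derivatives of a function in the Sobolev space: \<open>f'\<close> is
  the weak derivative of \<open>f\<close> and lies in \<open>L\<^sub>2\<close>. It covers the top derivative, which
  exists almost everywhere only, on the same footing as the lower ones.
\<close>

definition L2_derivative :: "(real \<Rightarrow> complex) \<Rightarrow> (real \<Rightarrow> complex) \<Rightarrow> bool" where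
  "L2_derivative f f' \<longleftrightarrow> abs_cont_on_unit f \<and>
     negligible {x \<in> {0..1}. \<not> (f has_vector_derivative f' x) (at x within {0..1})} \<and> L2_unit f'"

lemma L2_derivativeD:
  assumes "L2_derivative f f'"
  shows "abs_cont_on_unit f" "continuous_on {0..1} f" "L2_unit f" "L2_unit f'"
  using assms unfolding L2_derivative_def
  by (auto intro: abs_cont_on_unit_continuous L2_unit_continuous)

lemma L2_derivative_C1:
  assumes der: "\<And>x. x \<in> {0..1} \<Longrightarrow> (f has_vector_derivative f' x) (at x within {0..1})"
    and cont: "continuous_on {0..1} f'"
  shows "L2_derivative f f'"
proof -
  have "bounded (f' ` {0..1})"
    by (intro compact_imp_bounded compact_continuous_image cont) simp
  then obtain B where B: "\<forall>x\<in>{0..1}. cmod (f' x) \<le> B" by (auto simp: bounded_iff)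
  have "abs_cont_on_unit f"
  proof (rule abs_cont_on_unit_Lipschitz)
    fix x y :: real assume "x \<in> {0..1}" "y \<in> {0..1}"
    moreover have "onorm (\<lambda>h. h *\<^sub>R f' z) \<le> B" if "z \<in> {0..1}" for z
      using B that by (intro onorm_le) (auto simp: mult.commute[of B] intro!: mult_left_mono)
    ultimately show "cmod (f y - f x) \<le> B * \<bar>y - x\<bar>"
      using differentiable_bound[of "{0..1}" f "\<lambda>x h. h *\<^sub>R f' x" B y x] der
      by (simp add: has_vector_derivative_def)
  qed
  moreover have "{x \<in> {0..1}. \<not> (f has_vector_derivative f' x) (at x within {0..1})} = {}"
    using der by blast
  ultimately show ?thesis
    unfolding L2_derivative_def using L2_unit_continuous[OF cont] by (metis negligible_empty)
qed

lemma L2_derivative_integration_by_parts: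
  assumes f: "L2_derivative f f'"
    and v: "\<And>x. x \<in> {0..1} \<Longrightarrow> (v has_vector_derivative v' x) (at x within {0..1})"
    and v': "continuous_on {0..1} v'"
    and ab: "0 \<le> a" "a \<le> b" "b \<le> 1"
  shows "((\<lambda>x. f' x * v x) has_integral f b * v b - f a * v a - integral {a..b} (\<lambda>x. f x * v' x)) {a..b}"
proof -
  have product: "((\<lambda>x. f x * v' x + f' x * v x) has_integral f b * v b - f a * v a) {a..b}"
  proof (rule fundamental_theorem_of_calculus_abs_cont)
    show "abs_cont_on_unit (\<lambda>x. f x * v x)"
      using L2_derivativeD[OF f] L2_derivativeD[OF L2_derivative_C1[OF v v']] by (intro abs_cont_on_unit_mult)
    show "negligible {x \<in> {0..1}. \<not> (f has_vector_derivative f' x) (at x within {0..1})}"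
      using f by (simp add: L2_derivative_def)
  qed (use ab v in \<open>auto intro!: has_vector_derivative_mult\<close>)
  have "(\<lambda>x. f x * v' x) integrable_on {a..b}"
    using L2_derivativeD[OF f] v' ab
    by (intro integrable_continuous_interval continuous_intros)
       (auto elim: continuous_on_subset)
  then have "((\<lambda>x. f x * v' x) has_integral integral {a..b} (\<lambda>x. f x * v' x)) {a..b}"
    by (rule integrable_integral)
  from has_integral_diff[OF product this] show ?thesis by simp
qed

lemma fourier_coeff_L2_derivative:
  assumes f: "L2_derivative f f'" and per: "f 0 = f 1"
  shows "fourier_coeff f' h = 2 * of_real pi * \<i> * of_int h * fourier_coeff f h"
proof -
  have "((\<lambda>x. f' x * fourier_char (- h) x) has_integral
      f 1 * fourier_char (- h) 1 - f 0 * fourier_char (- h) 0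
      - integral {0..1} (\<lambda>x. f x * (2 * of_real pi * \<i> * of_int (- h) * fourier_char (- h) x))) {0..1}"
    by (intro L2_derivative_integration_by_parts f fourier_char_vector_derivative
        continuous_intros continuous_on_fourier_char) auto
  also have "integral {0..1} (\<lambda>x. f x * (2 * of_real pi * \<i> * of_int (- h) * fourier_char (- h) x))
      = integral {0..1} (\<lambda>x. - (2 * of_real pi * \<i> * of_int h) * (f x * fourier_char (- h) x))"
    by (intro integral_cong) simp
  also have "\<dots> = - (2 * of_real pi * \<i> * of_int h) * integral {0..1} (\<lambda>x. f x * fourier_char (- h) x)"
    by (rule integral_mult_right)
  finally show ?thesis
    using per by (simp add: fourier_coeff_def L2_inner_def cnj_fourier_char integral_unique)
qed

lemma nth_deriv_0 [simp]: "nth_deriv 0 f = f"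
  by (simp add: nth_deriv_def)

lemma nth_deriv_Suc: "nth_deriv (Suc l) f x = vector_derivative (nth_deriv l f) (at x within {0..1})"
  by (simp add: nth_deriv_def deriv_unit_def)

lemma L2_derivative_nth_deriv:
  assumes f: "f \<in> Sobolev s" and l: "l < s"
  shows "L2_derivative (nth_deriv l f) (nth_deriv (Suc l) f)"
proof (cases "l = s - 1")
  case True
  then have s: "Suc l = s" using l by simp
  have f': "abs_cont_on_unit (nth_deriv l f)" "L2_unit (nth_deriv (Suc l) f)"
    "AE x\<in>{0..1} in lebesgue. nth_deriv l f differentiable (at x within {0..1})"
    using f True unfolding Sobolev_def s by auto
  have "AE x in lebesgue. x \<notin> {x \<in> {0..1}. \<not> (nth_deriv l f has_vector_derivative nth_deriv (Suc l) f x) (at x within {0..1})}"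
    using f'(3) by eventually_elim (auto simp: nth_deriv_Suc vector_derivative_works)
  then have "negligible {x \<in> {0..1}. \<not> (nth_deriv l f has_vector_derivative nth_deriv (Suc l) f x) (at x within {0..1})}"
    unfolding eventually_ae_filter by (auto simp: negligible_iff_null_sets[symmetric] intro: negligible_subset)
  then show ?thesis using f' unfolding L2_derivative_def by blast
next
  case False
  then have l': "l < s - 1" using l by simp
  have diff: "nth_deriv j f differentiable (at x within {0..1})" if "j < s - 1" "x \<in> {0..1}" for j x
    using f that by (auto simp: Sobolev_def)
  show ?thesis
  proof (rule L2_derivative_C1)
    show "(nth_deriv l f has_vector_derivative nth_deriv (Suc l) f x) (at x within {0..1})" if "x \<in> {0..1}" for x
      using diff[OF l' that] by (simp add: nth_deriv_Suc vector_derivative_works)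
    show "continuous_on {0..1} (nth_deriv (Suc l) f)"
    proof (cases "Suc l = s - 1")
      case True
      then show ?thesis using f by (auto simp: Sobolev_def intro: abs_cont_on_unit_continuous)
    next
      case False
      then have "Suc l < s - 1" using l' by simp
      then show ?thesis
        using diff by (intro differentiable_imp_continuous_on) (auto simp: differentiable_on_def)
    qed
  qed
qed

text \<open>
  Periodicity of the derivatives of order below \<open>s\<close> removes the boundary terms in all \<open>l\<close>
  integrations by parts.
\<close>

lemma fourier_coeff_nth_deriv:
  assumes f: "f \<in> periodic_Sobolev s" and "l \<le> s"
  shows "fourier_coeff (nth_deriv l f) h = (2 * of_real pi * \<i> * of_int h) ^ l * fourier_coeff f h"
  using assms(2)
proof (induction l)
  case (Suc l)
  have "nth_deriv l f 0 = nth_deriv l f 1" "L2_derivative (nth_deriv l f) (nth_deriv (Suc l) f)"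
    using f Suc.prems by (auto simp: periodic_Sobolev_def intro: L2_derivative_nth_deriv)
  then show ?case
    using Suc fourier_coeff_L2_derivative by simp
qed simp

section \<open>Pointwise convergence of Fourier series\<close>

text \<open>
  The first periodic Bernoulli function of \<open>x - y\<close>: it has slope \<open>1\<close>, mean \<open>0\<close> and jumps from
  \<open>1/2\<close> down to \<open>- 1/2\<close> at \<open>y\<close>.
\<close>

definition sawtooth :: "real \<Rightarrow> real \<Rightarrow> complex" where
  "sawtooth y x = of_real (x - y + (if x \<le> y then 1/2 else - 1/2))"

lemma L2_unit_sawtooth:
  assumes "y \<in> {0..1}"
  shows "L2_unit (sawtooth y)"
proof (rule L2_unit_bounded)
  have "sawtooth y \<in> borel_measurable borel"
    unfolding sawtooth_def by measurable
  then show "sawtooth y \<in> borel_measurable (lebesgue_on {0..1})"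
    by (intro measurable_restrict_space1 measurable_completion) simp
  show "cmod (sawtooth y x) \<le> 3 / 2" if "x \<in> {0..1}" for x
    using assms that unfolding sawtooth_def norm_of_real by (cases "x \<le> y") (auto simp: abs_real_def)
qed

lemma has_integral_piecewise:
  fixes g :: "real \<Rightarrow> 'a::banach"
  assumes y: "0 \<le> y" "y \<le> 1"
    and u: "(u has_integral I) {0..y}" "\<And>x. x \<in> {0..y} \<Longrightarrow> g x = u x"
    and v: "(v has_integral J) {y..1}" "\<And>x. x \<in> {y<..1} \<Longrightarrow> g x = v x"
  shows "(g has_integral I + J) {0..1}"
proof (rule has_integral_combine[OF y])
  show "(g has_integral I) {0..y}" by (rule has_integral_eq[OF _ u(1)]) (simp add: u(2))
  show "(g has_integral J) {y..1}"
    by (rule has_integral_spike[OF negligible_sing[of y] _ v(1)]) (use v(2) in auto)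
qed

text \<open>
  Integration by parts on either side of \<open>y\<close>: the jump produces \<open>f y\<close>, the slope produces the mean
  of \<open>f\<close>, and the boundary terms at \<open>0\<close> and \<open>1\<close> cancel by periodicity.
\<close>

lemma L2_inner_sawtooth:
  assumes f: "L2_derivative f f'" and per: "f 0 = f 1" and y: "y \<in> {0..1}"
  shows "L2_inner f' (sawtooth y) = f y - fourier_coeff f 0"
proof -
  have parts: "((\<lambda>x. f' x * of_real (x - y + c)) has_integral
      f b * of_real (b - y + c) - f a * of_real (a - y + c) - integral {a..b} (\<lambda>x. f x * 1)) {a..b}"
    if "0 \<le> a" "a \<le> b" "b \<le> 1" for a b c
  proof (rule L2_derivative_integration_by_parts[OF f _ _ that])
    show "((\<lambda>x. of_real (x - y + c)) has_vector_derivative 1) (at x within {0..1})" for x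
      by (auto intro!: derivative_eq_intros has_vector_derivative_of_real)
  qed auto
  have "((\<lambda>x. f' x * cnj (sawtooth y x)) has_integral
      (f y * of_real (y - y + 1/2) - f 0 * of_real (0 - y + 1/2) - integral {0..y} (\<lambda>x. f x * 1))
    + (f 1 * of_real (1 - y + (-1/2)) - f y * of_real (y - y + (-1/2)) - integral {y..1} (\<lambda>x. f x * 1))) {0..1}"
    using y by (intro has_integral_piecewise[OF _ _ parts[of 0 y "1/2"] _ parts[of y 1 "-1/2"]])
      (auto simp: sawtooth_def)
  then have "L2_inner f' (sawtooth y) = f y - (integral {0..y} f + integral {y..1} f)"
    unfolding L2_inner_def using per by (simp add: integral_unique algebra_simps)
  also have "integral {0..y} f + integral {y..1} f = integral {0..1} f"
    using y L2_derivativeD(2)[OF f]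
    by (intro Henstock_Kurzweil_Integration.integral_combine integrable_continuous_interval) auto
  finally show ?thesis by (simp add: fourier_coeff_def L2_inner_def)
qed

lemma L2_inner_commute: "L2_inner g f = cnj (L2_inner f g)"
proof -
  have "L2_inner g f = integral {0..1} (\<lambda>x. cnj (f x * cnj (g x)))"
    unfolding L2_inner_def by (intro integral_cong) simp
  then show ?thesis unfolding L2_inner_def integral_cnj .
qed

text \<open>
  The representation \<open>L2_inner_sawtooth\<close>, applied to a character, reads off the
  coefficient, as the character is a multiple of its own derivative.
\<close>

lemma fourier_coeff_sawtooth:
  assumes y: "y \<in> {0..1}" and h: "h \<noteq> 0"
  shows "cnj (fourier_coeff (sawtooth y) h) = fourier_char h y / (2 * of_real pi * \<i> * of_int h)"
proof -
  let ?c = "2 * of_real pi * \<i> * of_int h"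
  have "L2_derivative (fourier_char h) (\<lambda>x. ?c * fourier_char h x)"
    by (intro L2_derivative_C1 fourier_char_vector_derivative continuous_intros continuous_on_fourier_char)
  then have "L2_inner (\<lambda>x. ?c * fourier_char h x) (sawtooth y) = fourier_char h y - fourier_coeff (fourier_char h) 0"
    by (rule L2_inner_sawtooth) (use y in auto)
  moreover have "fourier_coeff (fourier_char h) 0 = 0"
    using h by (simp add: fourier_coeff_def fourier_char_orthonormal)
  ultimately have "?c * L2_inner (fourier_char h) (sawtooth y) = fourier_char h y"
    using y by (simp add: L2_inner_cmult_left L2_unit_fourier_char L2_unit_sawtooth)
  moreover have "?c \<noteq> 0" using h by simp
  ultimately have "L2_inner (fourier_char h) (sawtooth y) = fourier_char h y / ?c"
    by (simp add: field_simps)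
  then show ?thesis
    using y by (simp add: fourier_coeff_def L2_inner_commute[of "sawtooth y"])
qed

lemma cmod_fourier_coeff_sawtooth:
  assumes y: "y \<in> {0..1}" and h: "h \<noteq> 0"
  shows "(cmod (fourier_coeff (sawtooth y) h))\<^sup>2 = 1 / (2 * pi * real_of_int h)\<^sup>2"
proof -
  have "cmod (fourier_coeff (sawtooth y) h) = cmod (fourier_char h y / (2 * of_real pi * \<i> * of_int h))"
    using fourier_coeff_sawtooth[OF assms] by (metis complex_mod_cnj)
  then show ?thesis by (simp add: norm_divide norm_mult power_divide power_mult_distrib)
qed

lemma L2_energy_sawtooth:
  assumes y: "y \<in> {0..1}"
  shows "L2_energy (sawtooth y) = 1 / 12"
proof -
  have sq: "((\<lambda>x. (x - y + c)\<^sup>2) has_integral (b - y + c) ^ 3 / 3 - (a - y + c) ^ 3 / 3) {a..b}"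
    if "a \<le> b" for a b c :: real
  proof (rule fundamental_theorem_of_calculus[OF that])
    fix x
    have "((\<lambda>x. (x - y + c) ^ 3 / 3) has_real_derivative (x - y + c)\<^sup>2) (at x within {a..b})"
      by (auto intro!: derivative_eq_intros)
    then show "((\<lambda>x. (x - y + c) ^ 3 / 3) has_vector_derivative (x - y + c)\<^sup>2) (at x within {a..b})"
      by (simp add: has_real_derivative_iff_has_vector_derivative)
  qed
  have "((\<lambda>x. (cmod (sawtooth y x))\<^sup>2) has_integral
      ((y - y + 1/2) ^ 3 / 3 - (0 - y + 1/2) ^ 3 / 3)
    + ((1 - y + (-1/2)) ^ 3 / 3 - (y - y + (-1/2)) ^ 3 / 3)) {0..1}"
    using y by (intro has_integral_piecewise[OF _ _ sq[of 0 y "1/2"] _ sq[of y 1 "-1/2"]])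
      (auto simp: sawtooth_def simp del: of_real_add of_real_diff)
  then show ?thesis
    unfolding L2_energy_def by (simp add: integral_unique power3_eq_cube field_simps)
qed

lemma L2_inner_diff_fourier_sum:
  assumes w: "L2_unit w" and g: "L2_unit g" and "finite F"
  shows "L2_unit (\<lambda>x. g x - (\<Sum>h\<in>F. c h * fourier_char h x)) \<and>
    L2_inner w (\<lambda>x. g x - (\<Sum>h\<in>F. c h * fourier_char h x))
         = L2_inner w g - (\<Sum>h\<in>F. cnj (c h) * fourier_coeff w h)"
  using \<open>finite F\<close>
proof (induction F)
  case empty
  then show ?case using g by simp
next
  case (insert h F)
  let ?r = "\<lambda>x. g x - (\<Sum>h\<in>F. c h * fourier_char h x)"
  have eq: "(\<lambda>x. g x - (\<Sum>g\<in>insert h F. c g * fourier_char g x))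
          = (\<lambda>x. ?r x - c h * fourier_char h x)"
    using insert.hyps by (simp add: algebra_simps)
  have r: "L2_unit ?r" using insert.IH by simp
  have ch: "L2_unit (\<lambda>x. c h * fourier_char h x)" by (intro L2_unit_cmult L2_unit_fourier_char)
  have "L2_inner (\<lambda>x. ?r x - c h * fourier_char h x) w
      = L2_inner ?r w - c h * L2_inner (fourier_char h) w"
    by (simp add: L2_inner_diff_left[OF r ch w] L2_inner_cmult_left[OF L2_unit_fourier_char w])
  then have "L2_inner w (\<lambda>x. ?r x - c h * fourier_char h x)
      = L2_inner w ?r - cnj (c h) * fourier_coeff w h"
    by (simp add: fourier_coeff_def L2_inner_commute[of w])
  then show ?case
    unfolding eq using insert L2_unit_diff[OF r ch] by simp
qed

lemma symmetric_sum_inverse_squares: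
  "(\<Sum>h\<in>{- int M..int M} - {0}. 1 / (2 * pi * real_of_int h)\<^sup>2) = (\<Sum>j<M. 1 / (real j + 1)\<^sup>2) / (2 * pi\<^sup>2)"
proof (induction M)
  case (Suc M)
  have "{- int (Suc M)..int (Suc M)} - {0} = insert (int (Suc M)) (insert (- int (Suc M)) ({- int M..int M} - {0}))"
    by auto
  moreover have "(2 * pi * (- 1 - real M))\<^sup>2 = (2 * pi * (1 + real M))\<^sup>2"
    by (simp add: power2_eq_square algebra_simps)
  ultimately have "(\<Sum>h\<in>{- int (Suc M)..int (Suc M)} - {0}. 1 / (2 * pi * real_of_int h)\<^sup>2)
      = 1 / (2 * pi * (real M + 1))\<^sup>2 + (1 / (2 * pi * (real M + 1))\<^sup>2
        + (\<Sum>h\<in>{- int M..int M} - {0}. 1 / (2 * pi * real_of_int h)\<^sup>2))"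
    by (simp add: add.commute)
  also have "1 / (2 * pi * (real M + 1))\<^sup>2 = 1 / (real M + 1)\<^sup>2 / (4 * pi\<^sup>2)"
    by (simp add: power_mult_distrib)
  finally show ?case unfolding Suc.IH by (simp add: field_simps)
qed simp

text \<open>
  Pairing \<open>f'\<close> with a partial sum of the Fourier series of the sawtooth gives the
  corresponding partial sum of the Fourier series of \<open>f\<close> at \<open>y\<close>, without its mean. So the error of the latter
  is at most the norm of \<open>f'\<close> times that of the remainder of the sawtooth series, whose square
  tends to \<open>1/12 - \<zeta>(2) / (2 \<pi>\<^sup>2) = 0\<close>.
\<close>

theorem fourier_partial_sums_converge:
  assumes f: "L2_derivative f f'" and per: "f 0 = f 1" and y: "y \<in> {0..1}"
  shows "(\<lambda>M. \<Sum>h\<in>{- int M..int M}. fourier_coeff f h * fourier_char h y) \<longlonglongrightarrow> f y"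
proof -
  let ?S = "\<lambda>M. \<Sum>h\<in>{- int M..int M}. fourier_coeff f h * fourier_char h y"
  let ?R = "\<lambda>M. 1 / 12 - (\<Sum>j<M. 1 / (real j + 1)\<^sup>2) / (2 * pi\<^sup>2)"
  have bound: "cmod (f y - ?S M) \<le> sqrt (L2_energy f' * ?R M)" for M
  proof -
    define F where "F = {- int M..int M} - {0}"
    have fin: "finite F" by (simp add: F_def)
    let ?r = "\<lambda>x. sawtooth y x - (\<Sum>h\<in>F. fourier_coeff (sawtooth y) h * fourier_char h x)"
    note saw = L2_unit_sawtooth[OF y]
    have "L2_inner f' ?r = f y - fourier_coeff f 0 - (\<Sum>h\<in>F. cnj (fourier_coeff (sawtooth y) h) * fourier_coeff f' h)"
      using L2_inner_diff_fourier_sum[OF L2_derivativeD(4)[OF f] saw fin] L2_inner_sawtooth[OF assms] by simp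
    also have "(\<Sum>h\<in>F. cnj (fourier_coeff (sawtooth y) h) * fourier_coeff f' h)
        = (\<Sum>h\<in>F. fourier_coeff f h * fourier_char h y)"
      by (intro sum.cong refl)
         (simp add: fourier_coeff_sawtooth[OF y] fourier_coeff_L2_derivative[OF f per] F_def)
    also have "f y - fourier_coeff f 0 - \<dots> = f y - ?S M"
      unfolding F_def by (subst sum.remove[of "{- int M..int M}" 0]) auto
    finally have inner: "L2_inner f' ?r = f y - ?S M" .
    have "(cmod (fourier_coeff (sawtooth y) h))\<^sup>2 = 1 / (2 * pi * real_of_int h)\<^sup>2" if "h \<in> F" for h
      using cmod_fourier_coeff_sawtooth[OF y] that by (simp add: F_def)
    then have "L2_energy ?r = ?R M"
      using L2_energy_fourier_residual(2)[OF saw fin] symmetric_sum_inverse_squares[of M]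
      by (simp add: L2_energy_sawtooth[OF y] F_def)
    then have "(cmod (f y - ?S M))\<^sup>2 \<le> L2_energy f' * ?R M"
      using L2_Cauchy_Schwarz[OF L2_derivativeD(4)[OF f] L2_energy_fourier_residual(1)[OF saw fin]] inner by simp
    then show ?thesis by (rule real_le_rsqrt)
  qed
  have "(\<lambda>M. \<Sum>j<M. 1 / (real j + 1)\<^sup>2) \<longlonglongrightarrow> pi\<^sup>2 / 6"
    using inverse_squares_sums by (simp add: sums_def add.commute)
  then have "(\<lambda>M. sqrt (L2_energy f' * ?R M)) \<longlonglongrightarrow> sqrt (L2_energy f' * (1 / 12 - pi\<^sup>2 / 6 / (2 * pi\<^sup>2)))"
    by (intro tendsto_intros) auto
  then have "(\<lambda>M. sqrt (L2_energy f' * ?R M)) \<longlonglongrightarrow> 0" by simp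
  then have "(\<lambda>M. f y - ?S M) \<longlonglongrightarrow> 0"
    by (rule Lim_null_comparison[rotated]) (simp add: bound)
  then show ?thesis
    using tendsto_diff[OF tendsto_const[of "f y"], of "\<lambda>M. f y - ?S M" 0] by simp
qed

section \<open>Upper bound: aliasing\<close>

lemma osc_integral_eq_fourier_coeff:
  assumes "L2_unit f"
  shows "osc_integral k f = fourier_coeff f k"
proof -
  have cnj: "cnj (fourier_char k x) = exp (- (2 * of_real pi * \<i> * of_int k * of_real x))" for x
    by (simp add: fourier_char_def exp_cnj)
  show ?thesis
    using set_lebesgue_integral_eq_integral(2)[OF L2_unit_inner_absolutely_integrable[OF assms L2_unit_fourier_char[of k]]]
    by (simp add: osc_integral_def fourier_coeff_def L2_inner_def cnj)
qed

lemma Re_Sobolev_inner_self: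
  assumes "L2_unit (nth_deriv s f)"
  shows "Re (Sobolev_inner s f f) =
    (\<Sum>l<s. (cmod (LINT x:{0..1}|lebesgue. nth_deriv l f x))\<^sup>2) + L2_energy (nth_deriv s f)"
proof -
  have "(LINT x:{0..1}|lebesgue. cnj (g x)) = cnj (LINT x:{0..1}|lebesgue. g x)" for g :: "real \<Rightarrow> complex"
    unfolding set_lebesgue_integral_def by (simp flip: Bochner_Integration.integral_cnj)
  moreover have "Re (z * cnj z) = (cmod z)\<^sup>2" for z
    by (simp add: complex_norm_square[symmetric])
  moreover have "Re (LINT x:{0..1}|lebesgue. nth_deriv s f x * cnj (nth_deriv s f x)) = L2_energy (nth_deriv s f)"
  proof -
    have "(LINT x:{0..1}|lebesgue. nth_deriv s f x * cnj (nth_deriv s f x)) = L2_inner (nth_deriv s f) (nth_deriv s f)"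
      unfolding L2_inner_def
      by (intro set_lebesgue_integral_eq_integral L2_unit_inner_absolutely_integrable assms)
    moreover have "Re (L2_inner (nth_deriv s f) (nth_deriv s f)) = L2_energy (nth_deriv s f)"
      using has_integral_Re[OF has_integral_L2_inner[OF assms assms]]
      unfolding L2_energy_def by (intro integral_unique[symmetric]) (simp add: complex_norm_square[symmetric])
    ultimately show ?thesis by simp
  qed
  ultimately show ?thesis unfolding Sobolev_inner_def by simp
qed

lemma L2_energy_le_Sobolev_norm:
  assumes "f \<in> Sobolev s" "Sobolev_norm s f \<le> 1"
  shows "L2_energy (nth_deriv s f) \<le> 1"
proof -
  have "L2_unit (nth_deriv s f)" using assms(1) by (simp add: Sobolev_def)
  then have "L2_energy (nth_deriv s f) \<le> Re (Sobolev_inner s f f)"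
    by (simp add: Re_Sobolev_inner_self sum_nonneg)
  also have "\<dots> \<le> 1" using assms(2) by (simp add: Sobolev_norm_def)
  finally show ?thesis .
qed

lemma cmod_fourier_coeff_nth_deriv:
  assumes "f \<in> periodic_Sobolev s" "h \<noteq> 0"
  shows "cmod (fourier_coeff f h) = cmod (fourier_coeff (nth_deriv s f) h) * (1 / (2 * pi * \<bar>real_of_int h\<bar>) ^ s)"
  using fourier_coeff_nth_deriv[OF assms(1) order_refl, of h] assms(2)
  by (simp add: norm_mult norm_power)

text \<open>
  Cauchy-Schwarz for \<open>f\<^sub>h = (f\<^sup>(\<^sup>s\<^sup>))\<^sub>h / (2 \<pi> i h)\<^sup>s\<close>, the first factor being controlled by Bessel's
  inequality. A singleton \<open>F\<close> gives the error of the zero algorithm.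
\<close>

lemma cmod_sum_fourier_coeff_le:
  assumes f: "f \<in> periodic_Sobolev s" "Sobolev_norm s f \<le> 1" and F: "finite F" "0 \<notin> F"
  shows "(cmod (\<Sum>h\<in>F. fourier_coeff f h))\<^sup>2 \<le> (\<Sum>h\<in>F. (1 / (2 * pi * \<bar>real_of_int h\<bar>) ^ s)\<^sup>2)"
proof -
  let ?w = "\<lambda>h. cmod (fourier_coeff (nth_deriv s f) h)" and ?d = "\<lambda>h. 1 / (2 * pi * \<bar>real_of_int h\<bar>) ^ s"
  have S: "f \<in> Sobolev s" using f by (simp add: periodic_Sobolev_def)
  have "cmod (\<Sum>h\<in>F. fourier_coeff f h) \<le> (\<Sum>h\<in>F. cmod (fourier_coeff f h))" by (rule norm_sum)
  also have "\<dots> = (\<Sum>h\<in>F. ?w h * ?d h)"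
    using F(2) by (intro sum.cong refl cmod_fourier_coeff_nth_deriv[OF f(1)]) auto
  finally have "(cmod (\<Sum>h\<in>F. fourier_coeff f h))\<^sup>2 \<le> (\<Sum>h\<in>F. ?w h * ?d h)\<^sup>2"
    by (rule power_mono) simp
  also have "\<dots> \<le> (\<Sum>h\<in>F. (?w h)\<^sup>2) * (\<Sum>h\<in>F. (?d h)\<^sup>2)"
    by (rule Cauchy_Schwarz_ineq_sum)
  also have "\<dots> \<le> 1 * (\<Sum>h\<in>F. (?d h)\<^sup>2)"
  proof (rule mult_right_mono)
    have "(\<Sum>h\<in>F. (?w h)\<^sup>2) \<le> L2_energy (nth_deriv s f)"
      using S by (intro Bessel_inequality F) (simp add: Sobolev_def)
    also have "\<dots> \<le> 1" by (rule L2_energy_le_Sobolev_norm[OF S f(2)])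
    finally show "(\<Sum>h\<in>F. (?w h)\<^sup>2) \<le> 1" .
  qed (simp add: sum_nonneg)
  finally show ?thesis by simp
qed

text \<open>
  The exact bound is \<open>\<pi>\<^sup>2/3\<close>. The weaker \<open>4\<close>, from a telescoping estimate, is what the constant
  \<open>2 = \<surd>4\<close> in the upper bound asks for.
\<close>

lemma sum_inverse_squares_le:
  fixes J :: "int set"
  assumes "finite J" "0 \<notin> J"
  shows "(\<Sum>j\<in>J. 1 / (real_of_int j)\<^sup>2) \<le> 4"
proof -
  have partial: "(\<Sum>j<M. 1 / (real j + 1)\<^sup>2) \<le> 2 - 1 / real M" for M
  proof (induction M)
    case (Suc M)
    show ?case
    proof (cases "M = 0")
      case False
      then have "1 / (real M + 1)\<^sup>2 \<le> 1 / (real M * (real M + 1))"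
        unfolding power2_eq_square by (intro divide_left_mono mult_right_mono) auto
      also have "\<dots> = 1 / real M - 1 / (real M + 1)" using False by (simp add: field_simps)
      finally have "1 / (real M + 1)\<^sup>2 \<le> 1 / real M - 1 / (real M + 1)" .
      then show ?thesis using Suc by (simp add: add.commute)
    qed simp
  qed simp
  define M where "M = nat (Max (abs ` J))"
  have M: "\<bar>j\<bar> \<le> int M" if "j \<in> J" for j
  proof -
    have "\<bar>j\<bar> \<le> Max (abs ` J)" using assms(1) that by simp
    moreover from this have "0 \<le> Max (abs ` J)" by linarith
    ultimately show ?thesis by (simp add: M_def)
  qed
  have "(\<Sum>j\<in>J. 1 / (2 * pi * real_of_int j)\<^sup>2) \<le> (\<Sum>j\<in>{- int M..int M} - {0}. 1 / (2 * pi * real_of_int j)\<^sup>2)"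
  proof (rule sum_mono2)
    show "J \<subseteq> {- int M..int M} - {0}"
    proof
      fix j assume "j \<in> J"
      then show "j \<in> {- int M..int M} - {0}" using M[of j] assms(2) by auto
    qed
  qed auto
  also have "\<dots> \<le> 2 / (2 * pi\<^sup>2)"
    unfolding symmetric_sum_inverse_squares
    by (intro divide_right_mono order_trans[OF partial]) auto
  finally have "(\<Sum>j\<in>J. 1 / (real_of_int j)\<^sup>2) / (4 * pi\<^sup>2) \<le> 1 / pi\<^sup>2"
    by (simp add: power_mult_distrib sum_divide_distrib mult.commute)
  then show ?thesis by (simp add: field_simps)
qed

text \<open>
  The reason for the factor \<open>3\<close>: at \<open>j = - 1\<close> and \<open>k > 0\<close> close to \<open>n/2\<close>, the alias is close to
  \<open>- n/2\<close> while \<open>n + |k|\<close> is close to \<open>3n/2\<close>.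
\<close>

lemma alias_term_le:
  fixes j :: int
  assumes "j \<noteq> 0" and k: "2 * \<bar>k\<bar> < int n"
  shows "\<bar>j\<bar> * (int n + \<bar>k\<bar>) \<le> 3 * \<bar>k + j * int n\<bar>"
proof -
  have j: "\<bar>j\<bar> \<ge> 1" using assms(1) by simp
  have "\<bar>j\<bar> * (2 * \<bar>k\<bar>) \<le> \<bar>j\<bar> * int n" using k by (intro mult_left_mono) auto
  moreover have "1 * \<bar>k\<bar> \<le> \<bar>j\<bar> * \<bar>k\<bar>" using j by (intro mult_right_mono) auto
  moreover have "\<bar>j\<bar> * int n - \<bar>k\<bar> \<le> \<bar>k + j * int n\<bar>"
  proof -
    have "\<bar>j\<bar> * int n = \<bar>j * int n\<bar>" by (simp add: abs_mult)
    then show ?thesis by linarith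
  qed
  ultimately show ?thesis unfolding distrib_left by linarith
qed

lemma sum_alias_terms_le:
  assumes s: "s \<ge> 1" and k: "2 * \<bar>k\<bar> < int n"
    and F: "finite F" "\<And>h. h \<in> F \<Longrightarrow> int n dvd h - k \<and> h \<noteq> k"
  shows "(\<Sum>h\<in>F. (1 / (2 * pi * \<bar>real_of_int h\<bar>) ^ s)\<^sup>2)
         \<le> 4 * ((3 / (2 * pi * (real n + \<bar>real_of_int k\<bar>))) ^ s)\<^sup>2"
proof -
  define C where "C = 3 / (2 * pi * (real n + \<bar>real_of_int k\<bar>))"
  have n: "n > 0" using k by linarith
  then have C: "C > 0" by (simp add: C_def)
  define q where "q h = (h - k) div int n" for h
  have q: "h = k + q h * int n" "q h \<noteq> 0" if "h \<in> F" for h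
    using F(2)[OF that] n by (auto simp: q_def)
  have "(1 / (2 * pi * \<bar>real_of_int h\<bar>) ^ s)\<^sup>2 \<le> (C ^ s)\<^sup>2 * (1 / (real_of_int (q h))\<^sup>2)" if h: "h \<in> F" for h
  proof -
    define j where "j = real_of_int \<bar>q h\<bar>"
    have j: "j \<ge> 1" using q(2)[OF h] by (simp add: j_def)
    have "\<bar>q h\<bar> * (int n + \<bar>k\<bar>) \<le> 3 * \<bar>h\<bar>"
      using alias_term_le[OF q(2)[OF h] k] q(1)[OF h] by simp
    then have "real_of_int (\<bar>q h\<bar> * (int n + \<bar>k\<bar>)) \<le> real_of_int (3 * \<bar>h\<bar>)" by linarith
    then have le: "j * (real n + \<bar>real_of_int k\<bar>) \<le> 3 * \<bar>real_of_int h\<bar>" by (simp add: j_def)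
    have pos: "0 < j * (real n + \<bar>real_of_int k\<bar>)" using j n by (intro mult_pos_pos) auto
    have h0: "\<bar>real_of_int h\<bar> > 0" using le pos by linarith
    have "1 / (2 * pi * \<bar>real_of_int h\<bar>) = 3 / (2 * pi * (3 * \<bar>real_of_int h\<bar>))" by simp
    also have "\<dots> \<le> 3 / (2 * pi * (j * (real n + \<bar>real_of_int k\<bar>)))"
      using le h0 j n by (intro divide_left_mono mult_left_mono mult_pos_pos) auto
    also have "\<dots> = C / j" by (simp add: C_def mult_ac)
    finally have "1 / (2 * pi * \<bar>real_of_int h\<bar>) \<le> C / j" .
    then have "(1 / (2 * pi * \<bar>real_of_int h\<bar>)) ^ s \<le> (C / j) ^ s" by (intro power_mono) auto
    also have "\<dots> = C ^ s / j ^ s" by (simp add: power_divide)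
    \<comment> \<open>As \<open>j \<ge> 1\<close>, one power of \<open>1/j\<close> suffices: its square is summable, uniformly in \<open>s\<close>.\<close>
    also have "\<dots> \<le> C ^ s / j ^ 1"
      using j C s by (intro divide_left_mono power_increasing mult_pos_pos) auto
    finally have "((1 / (2 * pi * \<bar>real_of_int h\<bar>)) ^ s)\<^sup>2 \<le> (C ^ s / j)\<^sup>2" by (intro power_mono) auto
    then show ?thesis by (simp add: j_def power_divide)
  qed
  then have "(\<Sum>h\<in>F. (1 / (2 * pi * \<bar>real_of_int h\<bar>) ^ s)\<^sup>2) \<le> (\<Sum>h\<in>F. (C ^ s)\<^sup>2 * (1 / (real_of_int (q h))\<^sup>2))"
    by (rule sum_mono)
  also have "\<dots> = (C ^ s)\<^sup>2 * (\<Sum>h\<in>F. 1 / (real_of_int (q h))\<^sup>2)" by (simp only: sum_distrib_left)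
  also have "(\<Sum>h\<in>F. 1 / (real_of_int (q h))\<^sup>2) = (\<Sum>j\<in>q ` F. 1 / (real_of_int j)\<^sup>2)"
    using q(1) by (intro sum.reindex[symmetric, unfolded o_def] inj_onI) metis
  also have "(C ^ s)\<^sup>2 * \<dots> \<le> (C ^ s)\<^sup>2 * 4"
    using F(1) q(2) by (intro mult_left_mono sum_inverse_squares_le) auto
  finally show ?thesis by (simp add: C_def)
qed

text \<open>The rectangle rule with \<open>n\<close> nodes, applied to the product of \<open>f\<close> with \<open>e\<^sup>-\<^sup>2\<^sup>\<pi>\<^sup>i\<^sup>k\<^sup>x\<close>.\<close>

definition modulated_mean :: "int \<Rightarrow> nat \<Rightarrow> (real \<Rightarrow> complex) \<Rightarrow> complex" where
  "modulated_mean k n f = (\<Sum>j<n. fourier_char (- k) (real j / real n) / of_nat n * f (real j / real n))"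

lemma modulated_mean_fourier_char:
  assumes "n \<ge> 1"
  shows "modulated_mean k n (fourier_char h) = of_bool (int n dvd h - k)"
proof -
  define z where "z = fourier_char (h - k) (1 / real n)"
  have pow: "fourier_char (h - k) (real j / real n) = z ^ j" for j
    unfolding z_def fourier_char_def exp_of_nat_mult[symmetric] by (simp add: field_simps)
  have mean: "modulated_mean k n (fourier_char h) = (\<Sum>j<n. z ^ j) / of_nat n"
    unfolding modulated_mean_def
    by (simp add: sum_divide_distrib flip: pow fourier_char_add)
  show ?thesis
  proof (cases "int n dvd h - k")
    case True
    then obtain m where m: "h - k = int n * m" by (auto simp: dvd_def)
    have "z = fourier_char m 1"
      unfolding z_def m fourier_char_def using assms by (simp add: field_simps)
    then show ?thesis using True assms by (simp add: mean)
  next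
    case False
    have "z \<noteq> 1"
    proof
      assume "z = 1"
      then obtain m :: int where "2 * pi * of_int (h - k) * (1 / real n) = of_int (2 * m) * pi"
        unfolding z_def fourier_char_def exp_eq_1 by auto
      then have "(2 * pi) * (real_of_int (h - k) / real n) = (2 * pi) * real_of_int m" by simp
      then have "real_of_int (h - k) / real n = real_of_int m" by (subst (asm) mult_left_cancel) auto
      then have "real_of_int (h - k) = real_of_int (m * int n)"
        using assms by (simp add: field_simps)
      then have "h - k = m * int n" by (simp only: of_int_eq_iff)
      then show False using False by simp
    qed
    moreover have "z ^ n = 1"
      using pow[of n] assms by simp
    ultimately show ?thesis using False by (simp add: mean geometric_sum)
  qed
qed

lemma modulated_mean_fourier_sum:
  assumes "n \<ge> 1" "finite H"
  shows "modulated_mean k n (\<lambda>x. \<Sum>h\<in>H. c h * fourier_char h x) = (\<Sum>h\<in>{h \<in> H. int n dvd h - k}. c h)"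
proof -
  have "modulated_mean k n (\<lambda>x. \<Sum>h\<in>H. c h * fourier_char h x)
      = (\<Sum>h\<in>H. c h * modulated_mean k n (fourier_char h))"
    unfolding modulated_mean_def sum_distrib_left by (subst sum.swap) (simp add: mult_ac)
  also have "\<dots> = (\<Sum>h\<in>H. if int n dvd h - k then c h else 0)"
    by (intro sum.cong refl) (simp add: modulated_mean_fourier_char[OF assms(1)])
  also have "\<dots> = (\<Sum>h\<in>{h \<in> H. int n dvd h - k}. c h)"
    using assms(2) by (simp add: sum.inter_filter)
  finally show ?thesis .
qed

text \<open>
  The bound is proved for the rule applied to symmetric partial sums of the Fourier series, where
  aliasing is a finite computation, and passes to the limit because the rule only
  sees the finitely many values \<open>f(j/n)\<close>.
\<close>

theorem modulated_mean_error:
  assumes s: "s \<ge> 1" and k: "2 * \<bar>k\<bar> < int n"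
    and f: "f \<in> periodic_Sobolev s" "Sobolev_norm s f \<le> 1"
  shows "cmod (fourier_coeff f k - modulated_mean k n f)
         \<le> 2 * (3 / (2 * pi * (real n + \<bar>real_of_int k\<bar>))) ^ s"
proof -
  let ?C = "(3 / (2 * pi * (real n + \<bar>real_of_int k\<bar>))) ^ s"
  let ?S = "\<lambda>M x. \<Sum>h\<in>{- int M..int M}. fourier_coeff f h * fourier_char h x"
  have n: "n \<ge> 1" using k by linarith
  have f': "L2_derivative f (nth_deriv 1 f)" "f 0 = f 1"
    using L2_derivative_nth_deriv[of f s 0] s f(1) by (force simp: periodic_Sobolev_def)+
  have "(\<lambda>M. ?S M (real j / real n)) \<longlonglongrightarrow> f (real j / real n)" if "j < n" for j
    using that by (intro fourier_partial_sums_converge[OF f']) auto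
  then have lim: "(\<lambda>M. cmod (fourier_coeff f k - modulated_mean k n (?S M)))
      \<longlonglongrightarrow> cmod (fourier_coeff f k - modulated_mean k n f)"
    unfolding modulated_mean_def by (intro tendsto_intros) auto
  have "cmod (fourier_coeff f k - modulated_mean k n (?S M)) \<le> 2 * ?C" if M: "M \<ge> nat \<bar>k\<bar>" for M
  proof -
    define A where "A = {h \<in> {- int M..int M}. int n dvd h - k}"
    have A: "finite A" "k \<in> A"
      using M by (auto simp: A_def intro: finite_subset[of _ "{- int M..int M}"])
    \<comment> \<open>The frequency \<open>0\<close>, at which \<open>f\<^sup>(\<^sup>s\<^sup>)\<close> gives no information, is not an alias as \<open>|k| < n\<close>.\<close>
    have nonzero: "0 \<notin> A - {k}"
    proof
      assume "0 \<in> A - {k}"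
      then have "int n dvd k" "k \<noteq> 0" by (auto simp: A_def)
      then show False using k dvd_imp_le_int[of k "int n"] by auto
    qed
    have "modulated_mean k n (?S M) = fourier_coeff f k + (\<Sum>h\<in>A - {k}. fourier_coeff f h)"
      unfolding modulated_mean_fourier_sum[OF n finite_atLeastAtMost_int] A_def[symmetric]
      by (rule sum.remove[OF A])
    then have "cmod (fourier_coeff f k - modulated_mean k n (?S M)) = cmod (\<Sum>h\<in>A - {k}. fourier_coeff f h)"
      by simp
    also have "\<dots> \<le> 2 * ?C"
    proof (rule power2_le_imp_le)
      have "(cmod (\<Sum>h\<in>A - {k}. fourier_coeff f h))\<^sup>2 \<le> (\<Sum>h\<in>A - {k}. (1 / (2 * pi * \<bar>real_of_int h\<bar>) ^ s)\<^sup>2)"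
        using A nonzero by (intro cmod_sum_fourier_coeff_le[OF f]) auto
      also have "\<dots> \<le> 4 * ?C\<^sup>2"
        using A by (intro sum_alias_terms_le s k) (auto simp: A_def)
      finally show "(cmod (\<Sum>h\<in>A - {k}. fourier_coeff f h))\<^sup>2 \<le> (2 * ?C)\<^sup>2"
        by (simp add: power_mult_distrib)
    qed simp
    finally show ?thesis .
  qed
  then show ?thesis
    by (intro tendsto_upperbound[OF lim]) (auto simp: eventually_sequentially)
qed

theorem min_wce_upper:
  assumes s: "s \<ge> 1" and n: "n \<ge> 1"
  shows "min_wce n k s \<le> ereal ((3 / (2 * pi)) ^ s * (2 / (real n + \<bar>real_of_int k\<bar>) ^ s))"
proof -
  let ?N = "real n + \<bar>real_of_int k\<bar>"
  have bound: "(3 / (2 * pi)) ^ s * (2 / ?N ^ s) = 2 * (3 / (2 * pi * ?N)) ^ s"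
    by (simp add: power_divide power_mult_distrib)
  have reduce: ?thesis
    if A: "A \<in> algorithms n s"
      and err: "\<And>f. f \<in> periodic_Sobolev s \<Longrightarrow> Sobolev_norm s f \<le> 1 \<Longrightarrow>
        cmod (fourier_coeff f k - A f) \<le> 2 * (3 / (2 * pi * ?N)) ^ s" for A
  proof -
    have "osc_integral k f = fourier_coeff f k" if "f \<in> periodic_Sobolev s" for f
      using L2_derivativeD(3)[OF L2_derivative_nth_deriv[of f s 0]] s that
      by (intro osc_integral_eq_fourier_coeff) (simp add: periodic_Sobolev_def)
    then have "wce k s A \<le> ereal (2 * (3 / (2 * pi * ?N)) ^ s)"
      unfolding wce_def using err by (intro SUP_least) auto
    then show ?thesis
      unfolding min_wce_def bound by (rule INF_lower2[OF A])
  qed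
  show ?thesis
  proof (cases "2 * \<bar>k\<bar> < int n")
    case True
    show ?thesis
    proof (rule reduce)
      show "modulated_mean k n \<in> algorithms n s"
        unfolding algorithms_def
        using s by (auto simp: modulated_mean_def fun_eq_iff
            intro!: exI[of _ "\<lambda>j. fourier_char (- k) (real j / real n) / of_nat n"] exI[of _ "\<lambda>_. 0::nat"]
              exI[of _ "\<lambda>j. real j / real n"])
    qed (rule modulated_mean_error[OF s True])
  next
    case False
    show ?thesis
    proof (rule reduce)
      show "(\<lambda>_. 0) \<in> algorithms n s"
        unfolding algorithms_def
        using s by (auto simp: fun_eq_iff intro!: exI[of _ "\<lambda>_. 0::complex"] exI[of _ "\<lambda>_. 0::nat"] exI[of _ "\<lambda>_. 0::real"])
      fix f assume f: "f \<in> periodic_Sobolev s" "Sobolev_norm s f \<le> 1"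
      have k: "k \<noteq> 0" using False n by auto
      then have "(cmod (fourier_coeff f k))\<^sup>2 \<le> (1 / (2 * pi * \<bar>real_of_int k\<bar>) ^ s)\<^sup>2"
        using cmod_sum_fourier_coeff_le[OF f, of "{k}"] by simp
      then have "cmod (fourier_coeff f k) \<le> 1 / (2 * pi * \<bar>real_of_int k\<bar>) ^ s"
        by (rule power2_le_imp_le) simp
      also have "\<dots> = (1 / (2 * pi * \<bar>real_of_int k\<bar>)) ^ s" by (simp add: power_divide)
      also have "\<dots> \<le> (3 / (2 * pi * ?N)) ^ s"
      proof (rule power_mono)
        have "real n \<le> 2 * \<bar>real_of_int k\<bar>" using False by linarith
        then have "3 / (2 * pi * (3 * \<bar>real_of_int k\<bar>)) \<le> 3 / (2 * pi * ?N)"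
          using k by (intro divide_left_mono mult_left_mono mult_pos_pos) auto
        then show "1 / (2 * pi * \<bar>real_of_int k\<bar>) \<le> 3 / (2 * pi * ?N)" by simp
      qed simp
      also have "\<dots> \<le> 2 * \<dots>" by simp
      finally show "cmod (fourier_coeff f k - 0) \<le> 2 * (3 / (2 * pi * ?N)) ^ s" by simp
    qed
  qed
qed

section \<open>Lower bound: fooling functions\<close>

text \<open>
  \<open>sine_power p l\<close> is the \<open>l\<close>-th derivative of \<open>sin(\<pi> x)\<^sup>2\<^sup>p\<close>. In terms of \<open>z = e\<^sup>2\<^sup>\<pi>\<^sup>i\<^sup>x\<close> the function
  \<open>sin(\<pi> x)\<^sup>2\<^sup>p\<close> equals \<open>z\<^sup>-\<^sup>p\<close> times the polynomial \<open>(- 1/4)\<^sup>p (z - 1)\<^sup>2\<^sup>p\<close>, and differentiation maps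
  \<open>z\<^sup>-\<^sup>p Q(z)\<close> to \<open>2 \<pi> i z\<^sup>-\<^sup>p (z Q'(z) - p Q(z))\<close>. Working with the polynomials
  makes the order of vanishing at the integers a matter of divisibility by powers of \<open>z - 1\<close>,
  and boundedness a matter of compactness.
\<close>

fun sine_power_poly :: "nat \<Rightarrow> nat \<Rightarrow> complex poly" where
  "sine_power_poly p 0 = smult ((- 1 / 4) ^ p) ([:- 1, 1:] ^ (2 * p))"
| "sine_power_poly p (Suc l) =
     smult (2 * of_real pi * \<i>)
       ([:0, 1:] * pderiv (sine_power_poly p l) - smult (of_nat p) (sine_power_poly p l))"

definition sine_power :: "nat \<Rightarrow> nat \<Rightarrow> real \<Rightarrow> complex" where
  "sine_power p l x = fourier_char (- int p) x * poly (sine_power_poly p l) (fourier_char 1 x)"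

lemma sine_power_0: "sine_power p 0 x = of_real (sin (pi * x) ^ (2 * p))"
proof -
  define z where "z = fourier_char 1 x"
  define w where "w = fourier_char (- 1) x"
  have zw: "w * z = 1" by (simp add: z_def w_def flip: fourier_char_add)
  have pow: "fourier_char (- int p) x = w ^ p"
    unfolding w_def fourier_char_def exp_of_nat_mult[symmetric] by (simp add: algebra_simps)
  have z: "z = of_real (cos (2 * (pi * x))) + \<i> * of_real (sin (2 * (pi * x)))"
    unfolding z_def fourier_char_def cis_conv_exp[symmetric]
    using cis_conv_exp[of "2 * (pi * x)"] by (simp add: complex_eq_iff mult_ac)
  have w: "w = of_real (cos (2 * (pi * x))) - \<i> * of_real (sin (2 * (pi * x)))"
    using cnj_fourier_char[of 1 x] z by (simp add: w_def z_def[symmetric])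
  have "w * (z - 1)\<^sup>2 = w * z * z - 2 * (w * z) + w"
    by (simp add: power2_eq_square algebra_simps)
  also have "\<dots> = of_real (2 * cos (2 * (pi * x)) - 2)" unfolding zw by (simp add: z w)
  also have "2 * cos (2 * (pi * x)) - 2 = - 4 * (sin (pi * x))\<^sup>2"
    unfolding cos_double_sin by simp
  finally have key: "- (w * (z - 1)\<^sup>2) / 4 = of_real ((sin (pi * x))\<^sup>2)" by simp
  have "sine_power p 0 x = w ^ p * ((- 1 / 4) ^ p * ((z - 1)\<^sup>2) ^ p)"
    by (simp add: sine_power_def pow z_def[symmetric] flip: power_mult)
  also have "\<dots> = (w * (- 1 / 4 * (z - 1)\<^sup>2)) ^ p"
    by (simp only: power_mult_distrib)
  also have "w * (- 1 / 4 * (z - 1)\<^sup>2) = - (w * (z - 1)\<^sup>2) / 4" by simp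
  finally have "sine_power p 0 x = (- (w * (z - 1)\<^sup>2) / 4) ^ p" .
  then show ?thesis unfolding key by (simp add: power_mult)
qed

lemma sine_power_vector_derivative:
  "(sine_power p l has_vector_derivative sine_power p (Suc l) x) (at x)"
proof -
  let ?Q = "sine_power_poly p l" and ?z = "fourier_char 1 x" and ?w = "fourier_char (- int p) x"
  have "((poly ?Q \<circ> fourier_char 1) has_vector_derivative
      (2 * of_real pi * \<i> * of_int 1 * ?z) * poly (pderiv ?Q) ?z) (at x)"
    by (intro field_vector_diff_chain_at fourier_char_vector_derivative poly_DERIV)
  then have "((\<lambda>x. fourier_char (- int p) x * (poly ?Q \<circ> fourier_char 1) x) has_vector_derivative
      ?w * ((2 * of_real pi * \<i> * of_int 1 * ?z) * poly (pderiv ?Q) ?z)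
      + (2 * of_real pi * \<i> * of_int (- int p) * ?w) * (poly ?Q \<circ> fourier_char 1) x) (at x)"
    by (intro has_vector_derivative_mult fourier_char_vector_derivative)
  then show ?thesis
    by (simp add: sine_power_def[abs_def] algebra_simps)
qed

lemma sine_power_poly_dvd:
  "l \<le> 2 * p \<Longrightarrow> [:- 1, 1:] ^ (2 * p - l) dvd sine_power_poly p l"
proof (induction l)
  case 0
  show ?case by (auto intro: dvd_smult)
next
  case (Suc l)
  define m where "m = 2 * p - Suc l"
  have m: "2 * p - l = Suc m" using Suc.prems by (simp add: m_def)
  obtain R where R: "sine_power_poly p l = [:- 1, 1:] ^ Suc m * R"
    using Suc by (auto simp: m dvd_def)
  have "[:- 1, 1:] ^ m dvd pderiv (sine_power_poly p l)"
    unfolding R pderiv_mult pderiv_power_Suc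
    by (rule dvd_add, rule dvd_mult2, rule le_imp_power_dvd, simp,
        rule dvd_mult, rule dvd_mult2, rule dvd_smult, rule dvd_refl)
  moreover have "[:- 1, 1:] ^ m dvd sine_power_poly p l"
    unfolding R by (intro dvd_mult2 le_imp_power_dvd) simp
  ultimately show ?case
    unfolding m_def[symmetric] sine_power_poly.simps by (intro dvd_smult dvd_diff dvd_mult)
qed

lemma sine_power_int:
  assumes "l < 2 * p"
  shows "sine_power p l (of_int i) = 0"
proof -
  have "[:- 1, 1:] dvd sine_power_poly p l"
    using sine_power_poly_dvd[of l p] assms dvd_power[of "2 * p - l" "[:- 1, 1 :: complex:]"]
    by (auto intro: dvd_trans)
  then have "poly (sine_power_poly p l) 1 = 0" by (simp add: poly_eq_0_iff_dvd)
  moreover have "fourier_char 1 (of_int i) = 1"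
    using exp_integer_2pi[of "of_int i"] by (simp add: fourier_char_def mult_ac)
  ultimately show ?thesis by (simp add: sine_power_def)
qed

lemma sine_power_bounded: "\<exists>B>0. \<forall>l\<le>s. \<forall>x. cmod (sine_power p l x) \<le> B"
proof -
  have "\<exists>b>0. \<forall>z. cmod z \<le> 1 \<longrightarrow> cmod (poly (sine_power_poly p l) z) \<le> b" for l
  proof -
    have "bounded (poly (sine_power_poly p l) ` cball 0 1)"
      by (intro compact_imp_bounded compact_continuous_image continuous_intros) simp
    then show ?thesis by (auto simp: bounded_pos)
  qed
  then obtain b where b: "\<And>l. b l > 0" "\<And>l z. cmod z \<le> 1 \<Longrightarrow> cmod (poly (sine_power_poly p l) z) \<le> b l"
    by metis
  show ?thesis
  proof (intro exI[of _ "\<Sum>l\<le>s. b l"] conjI allI impI)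
    show "(\<Sum>l\<le>s. b l) > 0" using b(1) by (intro sum_pos) auto
    fix l x assume "l \<le> s"
    have "cmod (sine_power p l x) \<le> b l"
      using b(2)[of "fourier_char 1 x" l] by (simp add: sine_power_def norm_mult)
    also have "\<dots> \<le> (\<Sum>l\<le>s. b l)"
      using b(1) \<open>l \<le> s\<close> by (intro member_le_sum) (auto intro: less_imp_le)
    finally show "cmod (sine_power p l x) \<le> (\<Sum>l\<le>s. b l)" .
  qed
qed

text \<open>
  Inside a cell the factor \<open>c\<close> is locally constant. At an end of a cell \<open>c\<close> jumps, but it is
  bounded and \<open>g\<close> vanishes to second order there, so the product still has derivative \<open>0\<close>.
\<close>

lemma cellwise_vector_derivative:
  fixes g :: "real \<Rightarrow> complex" and c :: "int \<Rightarrow> complex"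
  assumes g: "(g has_vector_derivative g') (at x)" and N: "N > 0"
    and c: "\<And>i. cmod (c i) \<le> K"
    and zero: "N * x \<in> \<int> \<Longrightarrow> g x = 0 \<and> g' = 0"
  shows "((\<lambda>x. c \<lfloor>N * x\<rfloor> * g x) has_vector_derivative c \<lfloor>N * x\<rfloor> * g') (at x)"
proof (cases "N * x \<in> \<int>")
  case True
  then have gx: "g x = 0" "g' = 0" using zero by auto
  have K: "K \<ge> 0" using order_trans[OF norm_ge_zero c[of 0]] .
  have g0: "\<forall>e>0. \<exists>d>0. \<forall>y. norm (y - x) < d \<longrightarrow> norm (g y) \<le> e * norm (y - x)"
    using g by (simp add: has_vector_derivative_def has_derivative_at_alt gx)
  have "\<exists>d>0. \<forall>y. norm (y - x) < d \<longrightarrow> norm (c \<lfloor>N * y\<rfloor> * g y) \<le> e * norm (y - x)" if "e > 0" for e :: real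
  proof -
    have "e / (K + 1) > 0" using K that by simp
    then obtain d where d: "d > 0" "\<And>y. norm (y - x) < d \<Longrightarrow> norm (g y) \<le> e / (K + 1) * norm (y - x)"
      using g0 by blast
    have "norm (c \<lfloor>N * y\<rfloor> * g y) \<le> e * norm (y - x)" if "norm (y - x) < d" for y
    proof -
      have "norm (c \<lfloor>N * y\<rfloor> * g y) \<le> (K + 1) * (e / (K + 1) * norm (y - x))"
        unfolding norm_mult using d(2)[OF that] c[of "\<lfloor>N * y\<rfloor>"] K by (intro mult_mono) auto
      also have "\<dots> = e * norm (y - x)" using K by simp
      finally show ?thesis .
    qed
    then show ?thesis using d(1) by blast
  qed
  then show ?thesis
    by (simp add: has_vector_derivative_def has_derivative_at_alt gx)
next
  case False
  let ?U = "{y. of_int \<lfloor>N * x\<rfloor> < N * y} \<inter> {y. N * y < of_int \<lfloor>N * x\<rfloor> + 1}"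
  have "((\<lambda>y. c \<lfloor>N * x\<rfloor> * g y) has_vector_derivative c \<lfloor>N * x\<rfloor> * g') (at x)"
    by (intro has_vector_derivative_mult_right g)
  moreover have "open ?U"
    by (intro open_Int open_Collect_less continuous_intros)
  moreover have "x \<in> ?U"
  proof -
    have "of_int \<lfloor>N * x\<rfloor> \<noteq> N * x" using False by (metis Ints_of_int)
    then have "of_int \<lfloor>N * x\<rfloor> < N * x" using of_int_floor_le[of "N * x"] by linarith
    then show ?thesis using floor_correct[of "N * x"] by auto
  qed
  moreover have "c \<lfloor>N * x\<rfloor> * g y = c \<lfloor>N * y\<rfloor> * g y" if "y \<in> ?U" for y
  proof -
    have "\<lfloor>N * y\<rfloor> = \<lfloor>N * x\<rfloor>" using that by (intro floor_unique) auto
    then show ?thesis by simp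
  qed
  ultimately show ?thesis by (rule has_vector_derivative_transform_within_open)
qed

text \<open>
  Lets one work with an explicit sequence \<open>F\<close> of successive derivatives instead of
  iterating \<^const>\<open>deriv_unit\<close>.
\<close>

lemma derivative_sequence_Sobolev:
  assumes s: "s \<ge> 1"
    and der: "\<And>l x. l < s \<Longrightarrow> x \<in> {0..1} \<Longrightarrow> (F l has_vector_derivative F (Suc l) x) (at x within {0..1})"
    and cont: "continuous_on {0..1} (F s)"
  shows "l \<le> s \<Longrightarrow> x \<in> {0..1} \<Longrightarrow> nth_deriv l (F 0) x = F l x"
    and "l \<le> s \<Longrightarrow> continuous_on {0..1} (nth_deriv l (F 0))"
    and "F 0 \<in> Sobolev s"
proof -
  have step: "(nth_deriv l (F 0) has_vector_derivative F (Suc l) x) (at x within {0..1})"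
    if "l < s" "x \<in> {0..1}" "\<And>y. y \<in> {0..1} \<Longrightarrow> nth_deriv l (F 0) y = F l y" for l x
    using der[OF that(1,2)] that(2,3) by (rule has_vector_derivative_transform[rotated 2]) auto
  have eq: "nth_deriv l (F 0) x = F l x" if "l \<le> s" "x \<in> {0..1}" for l x
    using that
  proof (induction l arbitrary: x)
    case (Suc l)
    then have "(nth_deriv l (F 0) has_vector_derivative F (Suc l) x) (at x within {0..1})"
      by (intro step) auto
    then show ?case
      unfolding nth_deriv_Suc using Suc.prems
      by (intro vector_derivative_within_closed_interval) auto
  qed simp
  have der': "(nth_deriv l (F 0) has_vector_derivative F (Suc l) x) (at x within {0..1})"
    if "l < s" "x \<in> {0..1}" for l x
    using that by (intro step eq) auto
  have cont': "continuous_on {0..1} (nth_deriv l (F 0))" if "l \<le> s" for l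
  proof (cases "l = s")
    case True
    then show ?thesis using cont continuous_on_cong[of "{0..1}" "{0..1}" "nth_deriv s (F 0)" "F s"] eq by auto
  next
    case False
    then have "l < s" using that by simp
    then show ?thesis
      unfolding continuous_on_eq_continuous_within using has_vector_derivative_continuous[OF der'] by blast
  qed
  have "L2_derivative (nth_deriv (s - 1) (F 0)) (F s)"
    using der'[of "s - 1"] s by (intro L2_derivative_C1 cont) auto
  then have "F 0 \<in> Sobolev s"
    unfolding Sobolev_def using der'[THEN differentiableI_vector] s L2_unit_continuous[OF cont'[of s]]
    by (auto dest: L2_derivativeD)
  then show "l \<le> s \<Longrightarrow> x \<in> {0..1} \<Longrightarrow> nth_deriv l (F 0) x = F l x"
    and "l \<le> s \<Longrightarrow> continuous_on {0..1} (nth_deriv l (F 0))"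
    and "F 0 \<in> Sobolev s"
    using eq cont' by auto
qed

lemma Sobolev_norm_le:
  assumes cont: "\<And>l. l \<le> s \<Longrightarrow> continuous_on {0..1} (nth_deriv l f)"
    and B: "\<And>l x. l \<le> s \<Longrightarrow> x \<in> {0..1} \<Longrightarrow> cmod (nth_deriv l f x) \<le> B"
  shows "Sobolev_norm s f \<le> sqrt (real s + 1) * B"
proof -
  have B0: "B \<ge> 0" using order_trans[OF norm_ge_zero B[of 0 0]] by simp
  have mean: "(cmod (LINT x:{0..1}|lebesgue. nth_deriv l f x))\<^sup>2 \<le> B\<^sup>2" if "l \<le> s" for l
  proof -
    have "(LINT x:{0..1}|lebesgue. nth_deriv l f x) = integral {0..1} (nth_deriv l f)"
      by (intro set_lebesgue_integral_eq_integral absolutely_integrable_continuous_real cont that)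
    moreover have "cmod (integral {0..1} (nth_deriv l f)) \<le> B * (1 - 0)"
      using B[OF that] by (intro integral_bound cont that) auto
    ultimately show ?thesis by (intro power_mono) auto
  qed
  have L2: "L2_unit (nth_deriv s f)" by (intro L2_unit_continuous cont) simp
  have "L2_energy (nth_deriv s f) \<le> integral {0..1} (\<lambda>_::real. B\<^sup>2)"
    unfolding L2_energy_def
    using has_integral_L2_energy[OF L2] B[of s]
    by (intro integral_le) (auto simp: has_integral_integrable intro: power_mono)
  then have energy: "L2_energy (nth_deriv s f) \<le> B\<^sup>2" by simp
  have "Re (Sobolev_inner s f f) \<le> (\<Sum>l<s. B\<^sup>2) + B\<^sup>2"
    unfolding Re_Sobolev_inner_self[OF L2] by (intro add_mono sum_mono mean energy) auto
  also have "\<dots> = (real s + 1) * B\<^sup>2" by (simp add: algebra_simps)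
  finally have "Sobolev_norm s f \<le> sqrt ((real s + 1) * B\<^sup>2)"
    unfolding Sobolev_norm_def by simp
  then show ?thesis using B0 by (simp add: real_sqrt_mult)
qed

text \<open>
  By induction on the number of cells. Each cell is an affine image of \<open>{0..1}\<close> under which the
  even power of the sine is invariant.
\<close>

lemma has_integral_cells:
  fixes w :: "int \<Rightarrow> real"
  assumes N: "N > 0" and S: "((\<lambda>x. sin (pi * x) ^ (2 * p)) has_integral S) {0..1}"
  shows "((\<lambda>x. w \<lfloor>N * x\<rfloor> * sin (pi * (N * x)) ^ (2 * p)) has_integral S / N * (\<Sum>i<m. w (int i))) {0..real m / N}"
proof (induction m)
  case 0
  show ?case using has_integral_refl by simp
next
  case (Suc m)
  let ?g = "\<lambda>x. w \<lfloor>N * x\<rfloor> * sin (pi * (N * x)) ^ (2 * p)"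
  have image: "(\<lambda>x. (1 / N) *\<^sub>R x + - ((1 / N) *\<^sub>R (- real m))) ` cbox 0 1 = {real m / N..real (Suc m) / N}"
    using N by (subst image_affinity_cbox) (simp add: field_simps)
  have "((\<lambda>x. sin (pi * (N *\<^sub>R x + - real m)) ^ (2 * p)) has_integral S / N) {real m / N..real (Suc m) / N}"
    using has_integral_affinity[of "\<lambda>x. sin (pi * x) ^ (2 * p)" S 0 1 N "- real m"] S N unfolding image by simp
  moreover have "sin (pi * (N *\<^sub>R x + - real m)) ^ (2 * p) = sin (pi * (N * x)) ^ (2 * p)" for x
  proof -
    have "sin (pi * (N * x) - real m * pi) = (- 1) ^ m * sin (pi * (N * x))"
      by (simp add: sin_diff cos_npi sin_npi)
    then have "(sin (pi * (N * x) - real m * pi))\<^sup>2 = (sin (pi * (N * x)))\<^sup>2"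
      by (simp add: power_mult_distrib flip: power_mult)
    then have "sin (pi * (N * x) - real m * pi) ^ (2 * p) = sin (pi * (N * x)) ^ (2 * p)"
      unfolding power_mult by simp
    moreover have "pi * (N *\<^sub>R x + - real m) = pi * (N * x) - real m * pi" by (simp add: algebra_simps)
    ultimately show ?thesis by simp
  qed
  ultimately have const: "((\<lambda>x. w (int m) * sin (pi * (N * x)) ^ (2 * p)) has_integral w (int m) * (S / N)) {real m / N..real (Suc m) / N}"
    by (intro has_integral_mult_right) simp
  have cell: "?g x = w (int m) * sin (pi * (N * x)) ^ (2 * p)"
    if "x \<in> {real m / N..real (Suc m) / N} - {real (Suc m) / N}" for x
  proof -
    have "\<lfloor>N * x\<rfloor> = int m" using that N by (intro floor_unique) (auto simp: field_simps)
    then show ?thesis by simp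
  qed
  have "(?g has_integral w (int m) * (S / N)) {real m / N..real (Suc m) / N}"
    by (rule has_integral_spike[OF negligible_sing cell const])
  from has_integral_combine[OF _ _ Suc this] N
  have "(?g has_integral S / N * (\<Sum>i<m. w (int i)) + w (int m) * (S / N)) {0..real (Suc m) / N}"
    by (simp add: divide_right_mono)
  then show ?case by (simp add: algebra_simps)
qed

lemma sine_power_mass:
  obtains S where "S > 0" "((\<lambda>x. sin (pi * x) ^ (2 * p)) has_integral S) {0..1}"
proof
  let ?f = "\<lambda>x. sin (pi * x) ^ (2 * p)"
  have cont: "continuous_on {0..1} ?f" by (intro continuous_intros)
  then show "(?f has_integral integral {0..1} ?f) {0..1}"
    by (intro integrable_integral integrable_continuous_interval)
  have "integral {0..1} ?f \<ge> 0"
    by (intro Henstock_Kurzweil_Integration.integral_nonneg integrable_continuous_interval cont) simp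
  moreover have "integral {0..1} ?f \<noteq> 0"
  proof
    assume "integral {0..1} ?f = 0"
    moreover have "integral {0..1} ?f = 0 \<longleftrightarrow> (\<forall>x\<in>{0..1}. ?f x = 0)"
      by (rule integral_eq_0_iff[OF cont]) auto
    ultimately have "\<forall>x\<in>{0..1}. ?f x = 0" by blast
    from bspec[OF this, of "1 / 2"] show False by simp
  qed
  ultimately show "integral {0..1} ?f > 0" by simp
qed

text \<open>
  The \<open>l\<close>-th derivative of the function that carries the bump \<open>sin(\<pi> m x)\<^sup>2\<^sup>s\<^sup>+\<^sup>2\<close> with coefficient
  \<open>c i\<close> on the cell \<open>[i/m, (i+1)/m)\<close>. The exponent is even, so that the bump is nonnegative,
  and so large that the derivatives of order up to \<open>s + 1\<close> vanish at the ends of the cells, which makes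
  even the \<open>s\<close>-th derivative differentiable, hence continuous.
\<close>

definition cell_function :: "nat \<Rightarrow> nat \<Rightarrow> (int \<Rightarrow> complex) \<Rightarrow> nat \<Rightarrow> real \<Rightarrow> complex" where
  "cell_function s m c l x =
     c \<lfloor>real m * x\<rfloor> * (of_nat m ^ l * sine_power (s + 1) l (real m * x))"

lemma cell_function_vector_derivative:
  assumes "m \<ge> 1" "\<And>i. cmod (c i) \<le> K" "l \<le> s"
  shows "(cell_function s m c l has_vector_derivative cell_function s m c (Suc l) x) (at x within A)"
proof -
  let ?g = "\<lambda>l x. of_nat m ^ l * sine_power (s + 1) l (real m * x)"
  have "(sine_power (s + 1) l \<circ> (\<lambda>x. real m * x) has_vector_derivative
      real m *\<^sub>R sine_power (s + 1) (Suc l) (real m * x)) (at x)"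
    by (intro vector_diff_chain_at sine_power_vector_derivative)
       (auto intro!: derivative_eq_intros simp flip: has_real_derivative_iff_has_vector_derivative)
  then have "(?g l has_vector_derivative of_nat m ^ l * (real m *\<^sub>R sine_power (s + 1) (Suc l) (real m * x))) (at x)"
    unfolding o_def by (rule has_vector_derivative_mult_right)
  then have "(?g l has_vector_derivative ?g (Suc l) x) (at x)"
    by (simp add: scaleR_conv_of_real mult_ac)
  moreover have "?g l x = 0 \<and> ?g (Suc l) x = 0" if "real m * x \<in> \<int>"
  proof -
    from that obtain i where "real m * x = of_int i" by (rule Ints_cases)
    then show ?thesis using assms(3) by (simp add: sine_power_int)
  qed
  ultimately have "((\<lambda>x. c \<lfloor>real m * x\<rfloor> * ?g l x) has_vector_derivative c \<lfloor>real m * x\<rfloor> * ?g (Suc l) x) (at x)"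
    using assms(1,2) by (intro cellwise_vector_derivative) auto
  then show ?thesis
    unfolding cell_function_def[abs_def] by (rule has_vector_derivative_at_within)
qed

lemma cell_function_Sobolev:
  assumes s: "s \<ge> 1" and m: "m \<ge> 1" and c: "\<And>i. cmod (c i) \<le> K"
    and B: "\<And>l x. l \<le> s \<Longrightarrow> cmod (sine_power (s + 1) l x) \<le> B"
  shows "l \<le> s \<Longrightarrow> x \<in> {0..1} \<Longrightarrow> nth_deriv l (cell_function s m c 0) x = cell_function s m c l x"
    and "cell_function s m c 0 \<in> periodic_Sobolev s"
    and "Sobolev_norm s (cell_function s m c 0) \<le> sqrt (real s + 1) * (K * (real m ^ s * B))"
    and "L2_unit (cell_function s m c 0)"
proof -
  have K: "K \<ge> 0" using order_trans[OF norm_ge_zero c[of 0]] .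
  have der: "(cell_function s m c l has_vector_derivative cell_function s m c (Suc l) x) (at x within A)"
    if "l \<le> s" for l x A
    using cell_function_vector_derivative[OF m c that] .
  have cont: "continuous_on {0..1} (cell_function s m c s)"
    unfolding continuous_on_eq_continuous_within using has_vector_derivative_continuous[OF der] by blast
  note seq = derivative_sequence_Sobolev[of s "cell_function s m c", OF s der cont, OF less_imp_le]
  show eq: "nth_deriv l (cell_function s m c 0) x = cell_function s m c l x" if "l \<le> s" "x \<in> {0..1}" for l x
    using seq(1) that by blast
  have ends: "cell_function s m c l 0 = 0" "cell_function s m c l 1 = 0" if "l < s" for l
    using that sine_power_int[of l "s + 1" 0] sine_power_int[of l "s + 1" "int m"]
    by (simp_all add: cell_function_def)
  show "cell_function s m c 0 \<in> periodic_Sobolev s"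
    using seq(3) eq ends by (auto simp: periodic_Sobolev_def)
  show "Sobolev_norm s (cell_function s m c 0) \<le> sqrt (real s + 1) * (K * (real m ^ s * B))"
  proof (rule Sobolev_norm_le)
    show "continuous_on {0..1} (nth_deriv l (cell_function s m c 0))" if "l \<le> s" for l
      using seq(2) that by blast
    show "cmod (nth_deriv l (cell_function s m c 0) x) \<le> K * (real m ^ s * B)" if "l \<le> s" "x \<in> {0..1}" for l x
      unfolding eq[OF that] cell_function_def norm_mult norm_power norm_of_nat
      using m K B[OF that(1)] that(1) by (intro mult_mono c power_increasing) auto
  qed
  show "L2_unit (cell_function s m c 0)"
    using seq(2)[of 0] by (intro L2_unit_continuous) simp
qed

text \<open>
  Each coefficient carries the phase of the left end of its cell. As the cells have length
  \<open>1/m\<close> and \<open>6|k| \<le> m\<close>, this phase differs from that of \<open>e\<^sup>2\<^sup>\<pi>\<^sup>i\<^sup>k\<^sup>x\<close> by at most \<open>\<pi>/3\<close> on the cell,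
  so the real part of the integrand is at least half its modulus and nothing cancels.
\<close>

lemma osc_integral_cell_function:
  fixes w :: "int \<Rightarrow> real"
  assumes m: "m \<ge> 1" "6 * \<bar>k\<bar> \<le> int m" and K: "K \<ge> 0" and w: "\<And>i. w i \<ge> 0"
    and S: "((\<lambda>x. sin (pi * x) ^ (2 * (s + 1))) has_integral S) {0..1}"
    and c: "\<And>i. c i = of_real (K * w i) * fourier_char k (of_int i / real m)"
    and L2: "L2_unit (cell_function s m c 0)"
  shows "K / 2 * (S / real m * (\<Sum>i<m. w (int i))) \<le> cmod (osc_integral k (cell_function s m c 0))"
proof -
  let ?f = "cell_function s m c 0" and ?h = "\<lambda>x. sin (pi * (real m * x)) ^ (2 * (s + 1))"
  have "((\<lambda>x. w \<lfloor>real m * x\<rfloor> * ?h x) has_integral S / real m * (\<Sum>i<m. w (int i))) {0..real m / real m}"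
    using m by (intro has_integral_cells S) auto
  then have "((\<lambda>x. w \<lfloor>real m * x\<rfloor> * ?h x) has_integral S / real m * (\<Sum>i<m. w (int i))) {0..1}"
    using m by simp
  then have low: "((\<lambda>x. K / 2 * (w \<lfloor>real m * x\<rfloor> * ?h x)) has_integral K / 2 * (S / real m * (\<Sum>i<m. w (int i)))) {0..1}"
    by (rule has_integral_mult_right)
  have high: "((\<lambda>x. Re (?f x * cnj (fourier_char k x))) has_integral Re (fourier_coeff ?f k)) {0..1}"
    unfolding fourier_coeff_def by (intro has_integral_Re has_integral_L2_inner L2 L2_unit_fourier_char)
  have "K / 2 * (S / real m * (\<Sum>i<m. w (int i))) \<le> Re (fourier_coeff ?f k)"
  proof (rule has_integral_le[OF low high])
    fix x :: real
    define t where "t = of_int \<lfloor>real m * x\<rfloor> / real m - x"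
    have t: "\<bar>t\<bar> \<le> 1 / real m"
    proof -
      have "real m * t = of_int \<lfloor>real m * x\<rfloor> - real m * x" using m by (simp add: t_def field_simps)
      then have "real m * \<bar>t\<bar> = \<bar>of_int \<lfloor>real m * x\<rfloor> - real m * x\<bar>"
        by (metis abs_mult abs_of_nat)
      also have "\<dots> \<le> 1" by linarith
      finally show ?thesis using m by (simp add: field_simps)
    qed
    have k: "\<bar>real_of_int k\<bar> \<le> real m / 6" using m by linarith
    have "\<bar>2 * pi * of_int k * t\<bar> = 2 * pi * (\<bar>of_int k\<bar> * \<bar>t\<bar>)" by (simp add: abs_mult)
    also have "\<dots> \<le> 2 * pi * ((real m / 6) * (1 / real m))"
      using t k by (intro mult_left_mono mult_mono) auto
    also have "\<dots> = pi / 3" using m by simp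
    finally have "cos (pi / 3) \<le> cos \<bar>2 * pi * of_int k * t\<bar>"
      by (intro cos_monotone_0_pi_le) auto
    then have cos: "cos (2 * pi * of_int k * t) \<ge> 1 / 2" by (simp add: cos_60)
    have h: "?h x \<ge> 0" by (rule zero_le_even_power')
    have "fourier_char k (of_int \<lfloor>real m * x\<rfloor> / real m) * cnj (fourier_char k x) = cis (2 * pi * of_int k * t)"
      unfolding cnj_fourier_char unfolding fourier_char_def cis_conv_exp exp_add[symmetric] t_def
      by (simp add: algebra_simps)
    then have "?f x * cnj (fourier_char k x) = of_real (K * w \<lfloor>real m * x\<rfloor> * ?h x) * cis (2 * pi * of_int k * t)"
      unfolding cell_function_def c sine_power_0 by (simp add: mult_ac)
    then have "Re (?f x * cnj (fourier_char k x)) = K * w \<lfloor>real m * x\<rfloor> * ?h x * cos (2 * pi * of_int k * t)"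
      by simp
    also have "\<dots> \<ge> K * w \<lfloor>real m * x\<rfloor> * ?h x * (1 / 2)"
      using K by (intro mult_left_mono mult_nonneg_nonneg w h cos)
    finally show "K / 2 * (w \<lfloor>real m * x\<rfloor> * ?h x) \<le> Re (?f x * cnj (fourier_char k x))" by simp
  qed
  also have "\<dots> \<le> cmod (osc_integral k ?f)"
    unfolding osc_integral_eq_fourier_coeff[OF L2] by (rule complex_Re_le_cmod)
  finally show ?thesis .
qed

text \<open>
  Each node switches off the cell containing it, so all data of the fooling function vanish.
  At most \<open>n \<le> m/2\<close> of the \<open>m\<close> cells are lost, and the coefficients are scaled by \<open>K\<close> to
  norm at most \<open>1\<close>.
\<close>

lemma wce_lower:
  assumes s: "s \<ge> 1" and n: "n \<ge> 1" and A: "A \<in> algorithms n s"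
    and B: "B > 0" "\<And>l x. l \<le> s \<Longrightarrow> cmod (sine_power (s + 1) l x) \<le> B"
    and S: "S > 0" "((\<lambda>x. sin (pi * x) ^ (2 * (s + 1))) has_integral S) {0..1}"
  shows "ereal (S / (4 * sqrt (real s + 1) * B * 6 ^ s) / (real n + \<bar>real_of_int k\<bar>) ^ s) \<le> wce k s A"
proof -
  obtain a l x where lx: "\<And>j. j < n \<Longrightarrow> l j < s \<and> x j \<in> {0..1}"
    and A: "A = (\<lambda>f. \<Sum>j<n. a j * nth_deriv (l j) f (x j))"
    using A unfolding algorithms_def by blast
  define m where "m = 6 * (n + nat \<bar>k\<bar>)"
  have m: "m \<ge> 1" "6 * \<bar>k\<bar> \<le> int m" "real m \<ge> 2 * real n" using n by (auto simp: m_def)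
  have m_real: "real m = 6 * (real n + \<bar>real_of_int k\<bar>)" by (simp add: m_def)
  define w :: "int \<Rightarrow> real" where "w i = of_bool (i \<notin> (\<lambda>j. \<lfloor>real m * x j\<rfloor>) ` {..<n})" for i
  define K where "K = 1 / (sqrt (real s + 1) * (real m ^ s * B))"
  have K: "K > 0" using m B by (simp add: K_def)
  define c where "c i = of_real (K * w i) * fourier_char k (of_int i / real m)" for i
  have c: "cmod (c i) \<le> K" for i using K by (simp add: c_def w_def norm_mult)
  let ?f = "cell_function s m c 0"
  note f = cell_function_Sobolev[OF s m(1) c B(2)]
  have "Sobolev_norm s ?f \<le> 1"
    using f(3) m B by (simp add: K_def)
  moreover have "A ?f = 0"
    unfolding A
  proof (rule sum.neutral, intro ballI)
    fix j assume "j \<in> {..<n}"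
    then have "nth_deriv (l j) ?f (x j) = cell_function s m c (l j) (x j)" "w \<lfloor>real m * x j\<rfloor> = 0"
      using lx[of j] by (auto simp: w_def intro: f(1))
    then show "a j * nth_deriv (l j) ?f (x j) = 0" by (simp add: cell_function_def c_def)
  qed
  moreover have "S / (4 * sqrt (real s + 1) * B * 6 ^ s) / (real n + \<bar>real_of_int k\<bar>) ^ s \<le> cmod (osc_integral k ?f)"
  proof -
    have "real m / 2 \<le> (\<Sum>i<m. w (int i))"
    proof -
      have "(\<Sum>i<m. 1 - w (int i)) = (\<Sum>i<m. of_bool (int i \<in> (\<lambda>j. \<lfloor>real m * x j\<rfloor>) ` {..<n}))"
        by (intro sum.cong refl) (simp add: w_def)
      also have "\<dots> = real (card {i. i < m \<and> int i \<in> (\<lambda>j. \<lfloor>real m * x j\<rfloor>) ` {..<n}})"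
        by (simp add: sum_of_bool_eq lessThan_def Int_def)
      also have "card {i. i < m \<and> int i \<in> (\<lambda>j. \<lfloor>real m * x j\<rfloor>) ` {..<n}}
          \<le> card ((\<lambda>j. nat \<lfloor>real m * x j\<rfloor>) ` {..<n})"
        by (intro card_mono) force+
      also have "\<dots> \<le> n" using card_image_le[of "{..<n}"] by force
      finally have "(\<Sum>i<m. 1 - w (int i)) \<le> real n" by simp
      then show ?thesis using m(3) by (simp add: sum_subtractf)
    qed
    then have "K / 2 * (S / real m * (real m / 2)) \<le> K / 2 * (S / real m * (\<Sum>i<m. w (int i)))"
      using K S by (intro mult_left_mono) auto
    also have "\<dots> \<le> cmod (osc_integral k ?f)"
      using K by (intro osc_integral_cell_function m S(2) f(4) c_def) (auto simp: w_def)
    also have "K / 2 * (S / real m * (real m / 2)) = K * S / 4" using m by simp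
    also have "\<dots> = S / (4 * sqrt (real s + 1) * B * 6 ^ s) / (real n + \<bar>real_of_int k\<bar>) ^ s"
      unfolding K_def m_real power_mult_distrib by (simp add: mult_ac)
    finally show ?thesis .
  qed
  ultimately show ?thesis
    unfolding wce_def using f(2) by (intro SUP_upper2[of ?f]) auto
qed

section \<open>The order of the minimal errors\<close>

theorem theorem9:
  fixes s :: nat
  assumes "s \<ge> 1"
  shows "\<exists>c::real. c > 0 \<and>
    (\<forall>(k::int) (n::nat). n \<ge> 1 \<longrightarrow>
       ereal (c / (real n + \<bar>real_of_int k\<bar>) ^ s) \<le> min_wce n k s \<and>
       min_wce n k s \<le> ereal ((3 / (2 * pi)) ^ s * (2 / (real n + \<bar>real_of_int k\<bar>) ^ s)))"
proof -
  obtain B where B: "B > 0" "\<And>l x. l \<le> s \<Longrightarrow> cmod (sine_power (s + 1) l x) \<le> B"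
    using sine_power_bounded by blast
  obtain S where S: "S > 0" "((\<lambda>x. sin (pi * x) ^ (2 * (s + 1))) has_integral S) {0..1}"
    by (rule sine_power_mass)
  show ?thesis
  proof (intro exI[of _ "S / (4 * sqrt (real s + 1) * B * 6 ^ s)"] conjI allI impI)
    show "S / (4 * sqrt (real s + 1) * B * 6 ^ s) > 0" using B S by simp
    fix k :: int and n :: nat assume n: "n \<ge> 1"
    show "ereal (S / (4 * sqrt (real s + 1) * B * 6 ^ s) / (real n + \<bar>real_of_int k\<bar>) ^ s) \<le> min_wce n k s"
      unfolding min_wce_def by (intro INF_greatest wce_lower assms n B S)
    show "min_wce n k s \<le> ereal ((3 / (2 * pi)) ^ s * (2 / (real n + \<bar>real_of_int k\<bar>) ^ s))"
      by (rule min_wce_upper[OF assms n])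
  qed
qed

end
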